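(* Let $\mathbf{A}$ be a finite relation algebra. Then (1) $\mathbf{A}$ has a fully universal representation if and only if the class of all consistent atomic $\mathbf{A}$-networks has $\mathrm{AP}(3,2,n)$ for all $n$; (2) $\mathbf{A}$ has a fully universal square representation if and only if the class of all consistent atomic $\mathbf{A}$-networks has the JEP and $\mathrm{AP}(3,2,n)$ for all $n$.
   Context: A relation algebra is an algebra $\mathbf{A}=(A;\cup,\bar{\ },0,1,\mathrm{Id},\breve{\ },\circ)$ such that, with $x\cap y:=\overline{(\bar x\cup\bar y)}$, the structure $(A;\cup,\cap,\bar{\ },0,1)$ is a Boolean algebra, $\circ$ is associative, and for all $a,b,c\in A$: $(a\cup b)\circ c=(a\circ c)\cup(b\circ c)$; $a\circ\mathrm{Id}=a$; $\breve{\breve a}=a$; $(a\cup b)\breve{\ }=\breve a\cup\breve b$; $(a\circ b)\breve{\ }=\breve b\circ\breve a$; $\bar b\cup(\breve a\circ\overline{(a\circ b)})=\bar b$. Write $a\le b$ if $a\cap b=a$. An atom is a minimal element of $A\setminus\{0\}$ with respect to $\le$. A representation of $\mathbf{A}$ is a relational structure $\mathfrak{B}$ with domain $B$ (possibly empty) and a binary relation $a^{\mathfrak{B}}\subseteq B^2$ for each $a\in A$ such that for all $a,b\in A$: $0^{\mathfrak{B}}=\varnothing$; $1^{\mathfrak{B}}=\bigcup_{a\in A}a^{\mathfrak{B}}$; $\mathrm{Id}^{\mathfrak{B}}=\{(u,u)\mid u\in B\}$; $(\bar a)^{\mathfrak{B}}=1^{\mathfrak{B}}\setminus a^{\mathfrak{B}}$;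 $(\breve a)^{\mathfrak{B}}=\{(u,v)\mid(v,u)\in a^{\mathfrak{B}}\}$; $(a\cup b)^{\mathfrak{B}}=a^{\mathfrak{B}}\cup b^{\mathfrak{B}}$; $(a\circ b)^{\mathfrak{B}}=a^{\mathfrak{B}}\circ b^{\mathfrak{B}}$ (the usual composition of binary relations). It is square if $1^{\mathfrak{B}}=B^2$. An $\mathbf{A}$-network $(V,f)$ is a finite set $V$ together with a function $f\colon V^2\to A$. It is atomic if every $f(x,y)$ is an atom, and consistent if $f(x,x)\le\mathrm{Id}$ and $f(x,y)\le f(x,z)\circ f(z,y)$ for all $x,y,z\in V$. It is satisfiable in a representation $\mathfrak{B}$ if there is $s\colon V\to B$ with $(s(x),s(y))\in f(x,y)^{\mathfrak{B}}$ for all $x,y\in V$. A representation is fully universal if every consistent atomic $\mathbf{A}$-network is satisfiable in it. A class $\mathcal{C}$ of consistent atomic $\mathbf{A}$-networks has $\mathrm{AP}(k,l,m)$ if for any $(V_1,f_1),(V_2,f_2)\in\mathcal{C}$ with $|V_1|=k$, $|V_1\cap V_2|=l$, $|V_2|=m$ and $f_1(a,b)=f_2(a,b)$ for all $a,b\in V_1\cap V_2$, there is $(V_1\cup V_2,f)\in\mathcal{C}$ with $f(a,b)=f_i(a,b)$ for all $i\in\{1,2\}$ and $a,b\in V_i$. It has the JEP (joint embedding property) if it has $\mathrm{AP}(k,0,m)$ for all $k,m\in\mathbb{N}$. *)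

theory Defs
  imports Main "HOL-Library.FuncSet" "HOL-Library.Infinite_Typeclass"
begin

(* The Boolean part is the library class: sup, inf, uminus, bot, top are the operations
   union, intersection, complement, 0, 1; in this class inf x y = - (sup (- x) (- y)) and
   x \<le> y \<longleftrightarrow> inf x y = x are theorems. The one-element algebra (bot = top) is allowed. *)
class relation_algebra = boolean_algebra +
  fixes ident :: 'a
    and conv :: "'a \<Rightarrow> 'a"  (\<open>_\<^sup>\<smile>\<close> [1000] 999)
    and rcomp :: "'a \<Rightarrow> 'a \<Rightarrow> 'a"  (infixl \<open>\<odot>\<close> 75)
  assumes rcomp_assoc: "(a \<odot> b) \<odot> c = a \<odot> (b \<odot> c)"
    and rcomp_sup_distrib: "(sup a b) \<odot> c = sup (a \<odot> c) (b \<odot> c)"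
    and rcomp_ident: "a \<odot> ident = a"
    and conv_conv: "(a\<^sup>\<smile>)\<^sup>\<smile> = a"
    and conv_sup: "(sup a b)\<^sup>\<smile> = sup (a\<^sup>\<smile>) (b\<^sup>\<smile>)"
    and conv_rcomp: "(a \<odot> b)\<^sup>\<smile> = b\<^sup>\<smile> \<odot> a\<^sup>\<smile>"
    and tarski: "sup (- b) (a\<^sup>\<smile> \<odot> (- (a \<odot> b))) = - b"

definition atom :: "'a::relation_algebra \<Rightarrow> bool" where
  "atom a \<longleftrightarrow> a \<noteq> bot \<and> (\<forall>b. b \<noteq> bot \<and> b \<le> a \<longrightarrow> b = a)"

(* The domain is an arbitrary, possibly empty, subset of 'b. Quantifying existentially over B and R
   for an infinite type 'b expresses the existence of a representation: a finite domain embeds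
   into 'b, and a finite algebra with a representation of the kind considered has a countable one. *)
definition representation :: "'b set \<Rightarrow> ('a::relation_algebra \<Rightarrow> 'b rel) \<Rightarrow> bool" where
  "representation B R \<longleftrightarrow>
     (\<forall>a. R a \<subseteq> B \<times> B) \<and>
     R bot = {} \<and>
     R top = (\<Union>a. R a) \<and>
     R ident = Id_on B \<and>
     (\<forall>a. R (- a) = R top - R a) \<and>
     (\<forall>a. R (a\<^sup>\<smile>) = {(u, v). (v, u) \<in> R a}) \<and>
     (\<forall>a b. R (sup a b) = R a \<union> R b) \<and>
     (\<forall>a b. R (a \<odot> b) = R a O R b)"

definition square :: "'b set \<Rightarrow> ('a::relation_algebra \<Rightarrow> 'b rel) \<Rightarrow> bool" where
  "square B R \<longleftrightarrow> R top = B \<times> B"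

(* Vertices range over a type 'v. The function of a network is a function on V \<times> V proper,
   i.e. it takes the value undefined elsewhere. *)
type_synonym ('v, 'a) network = "'v set \<times> ('v \<times> 'v \<Rightarrow> 'a)"

definition network :: "('v, 'a::relation_algebra) network \<Rightarrow> bool" where
  "network = (\<lambda>(V, f). finite V \<and> f \<in> V \<times> V \<rightarrow>\<^sub>E UNIV)"

definition atomic :: "('v, 'a::relation_algebra) network \<Rightarrow> bool" where
  "atomic = (\<lambda>(V, f). \<forall>x\<in>V. \<forall>y\<in>V. atom (f (x, y)))"

definition consistent :: "('v, 'a::relation_algebra) network \<Rightarrow> bool" where
  "consistent = (\<lambda>(V, f).
     (\<forall>x\<in>V. f (x, x) \<le> ident) \<and>
     (\<forall>x\<in>V. \<forall>y\<in>V. \<forall>z\<in>V. f (x, y) \<le> f (x, z) \<odot> f (z, y)))"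

definition consistent_atomic_networks :: "('v, 'a::relation_algebra) network set" where
  "consistent_atomic_networks = {N. network N \<and> consistent N \<and> atomic N}"

definition satisfiable ::
  "'b set \<Rightarrow> ('a::relation_algebra \<Rightarrow> 'b rel) \<Rightarrow> ('v, 'a) network \<Rightarrow> bool" where
  "satisfiable B R = (\<lambda>(V, f).
     \<exists>s. s \<in> V \<rightarrow> B \<and> (\<forall>x\<in>V. \<forall>y\<in>V. (s x, s y) \<in> R (f (x, y))))"

(* The first argument only names the vertex type. All notions are invariant under renaming
   vertices, so over an infinite type 'v this covers every finite set of vertices. *)
definition fully_universal ::
  "'v itself \<Rightarrow> 'b set \<Rightarrow> ('a::relation_algebra \<Rightarrow> 'b rel) \<Rightarrow> bool" where
  "fully_universal _ B R \<longleftrightarrow>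
     (\<forall>N \<in> (consistent_atomic_networks :: ('v, 'a) network set). satisfiable B R N)"

definition AP ::
  "('v, 'a::relation_algebra) network set \<Rightarrow> nat \<Rightarrow> nat \<Rightarrow> nat \<Rightarrow> bool" where
  "AP C k l m \<longleftrightarrow>
     (\<forall>V\<^sub>1 f\<^sub>1 V\<^sub>2 f\<^sub>2.
        (V\<^sub>1, f\<^sub>1) \<in> C \<and> (V\<^sub>2, f\<^sub>2) \<in> C \<and>
        card V\<^sub>1 = k \<and> card (V\<^sub>1 \<inter> V\<^sub>2) = l \<and> card V\<^sub>2 = m \<and>
        (\<forall>a \<in> V\<^sub>1 \<inter> V\<^sub>2. \<forall>b \<in> V\<^sub>1 \<inter> V\<^sub>2. f\<^sub>1 (a, b) = f\<^sub>2 (a, b)) \<longrightarrow>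
        (\<exists>f. (V\<^sub>1 \<union> V\<^sub>2, f) \<in> C \<and>
             (\<forall>a\<in>V\<^sub>1. \<forall>b\<in>V\<^sub>1. f (a, b) = f\<^sub>1 (a, b)) \<and>
             (\<forall>a\<in>V\<^sub>2. \<forall>b\<in>V\<^sub>2. f (a, b) = f\<^sub>2 (a, b))))"

definition JEP :: "('v, 'a::relation_algebra) network set \<Rightarrow> bool" where
  "JEP C \<longleftrightarrow> (\<forall>k m. AP C k 0 m)"

end

(* From left to right, satisfying assignments are glued inside the representation and the atoms
   containing the resulting pairs are read off. Conversely, AP(3,2,n) says that a demand
   f (x, y) <= q o r on a network can be met by adding a point. Meeting all demands along a chain of
   networks yields a countable saturated network, whose quotient by f (x, y) <= Id is a
   representation with a single component. The disjoint union of such representations over all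
   networks is fully universal; under the JEP all networks can be embedded along one chain, so a
   single component suffices. *)
theory Submission
  imports Defs "HOL-Analysis.Finite_Cartesian_Product"
begin

section \<open>Relation algebras\<close>

text \<open>A consistent network may have distinct vertices joined by an atom below
  \<open>ident\<close>; every satisfying assignment identifies such twins. Hence assignments and
  embeddings are allowed to be non-injective, a glued point may coincide with an old one, and the
  limit has to be divided by this relation. Twins also close a gap: \<open>AP\<close> with
  parameters 3, 2, n speaks of exactly three vertices meeting the others in exactly two, while a
  demand may sit at a single vertex. The left-to-right direction of (1) applies universality to the
  larger network only. The third vertex of the triangle is found by composition in the
  representation, and the common vertices keep all points in one class of the equivalence relation
  \<open>R top\<close>; for networks without common vertices it is squareness that provides this.
  The parameter n is unbounded because it is the size of the current network in the chain.
  Enumerating demands and networks takes countability, so the chains live on \<open>nat\<close>, and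
  the infinite types of the statement enter through injections from \<open>nat\<close>.\<close>

lemma atom_le_iff_inf:
  assumes "atom p"
  shows "p \<le> a \<longleftrightarrow> inf p a \<noteq> bot"
proof
  assume "p \<le> a"
  then show "inf p a \<noteq> bot"
    using assms by (auto simp: atom_def inf_absorb1)
next
  assume "inf p a \<noteq> bot"
  then have "inf p a = p"
    using assms by (auto simp: atom_def)
  then show "p \<le> a"
    by (simp add: inf.absorb_iff1)
qed

lemma atom_le_atom: "atom p \<Longrightarrow> atom q \<Longrightarrow> p \<le> q \<Longrightarrow> p = q"
  by (auto simp: atom_def)

lemma atom_le_sup:
  assumes "atom p" "p \<le> sup a b"
  shows "p \<le> a \<or> p \<le> b"
  using assms by (auto simp: atom_le_iff_inf inf_sup_distrib1)

lemma atom_le_uminus: "atom p \<Longrightarrow> p \<le> - a \<longleftrightarrow> \<not> p \<le> a"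
  by (metis atom_le_iff_inf inf_shunt)

text \<open>Meant for properties such as \<open>p \<le> q \<odot> b\<close> in the variable b, or
  membership of a fixed pair in \<open>R b\<close>: they hold of a join only if they hold of a part.
  Finiteness gives a minimal element with the property; a nonzero b strictly below it would split
  it, and one of the two parts would contradict minimality.\<close>

lemma exists_atom_of_prime:
  fixes a :: "'a::{finite,relation_algebra}"
  assumes "P a" "\<not> P bot" and prime: "\<And>b c. P (sup b c) \<Longrightarrow> P b \<or> P c"
  shows "\<exists>p. atom p \<and> p \<le> a \<and> P p"
proof -
  obtain p where p: "p \<le> a" "P p" and minimal: "\<And>b. P b \<Longrightarrow> b \<le> p \<Longrightarrow> b = p"
    using finite_has_minimal2[of "{b. P b}" a] assms(1) by auto
  have "b = p" if "b \<noteq> bot" "b \<le> p" for b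
  proof -
    have "P (sup b (inf p (- b)))"
      using p(2) that(2) by (simp add: sup_inf_distrib1 sup_absorb2)
    then consider "P b" | "P (inf p (- b))"
      using prime by blast
    then show ?thesis
    proof cases
      case 1
      then show ?thesis using minimal that by blast
    next
      case 2
      then have "inf p (- b) = p" using minimal by simp
      then have "b \<le> - b" using that(2) by (metis inf.cobounded2 order_trans)
      then have "b = bot" by (metis inf.absorb1 inf_compl_bot)
      with that show ?thesis by simp
    qed
  qed
  moreover have "p \<noteq> bot" using p assms(2) by auto
  ultimately show ?thesis using p by (auto simp: atom_def)
qed

section \<open>Arithmetic of composition and converse\<close>

context relation_algebra
begin

text \<open>Converse swaps the factors and so turns a law for one side into its mirror image;
  \<open>ident_rcomp\<close> and \<open>bot_rcomp\<close> follow the same pattern.\<close>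

lemma rcomp_sup_distrib_left: "a \<odot> sup b c = sup (a \<odot> b) (a \<odot> c)"
proof -
  have "(a \<odot> sup b c)\<^sup>\<smile> = (sup (a \<odot> b) (a \<odot> c))\<^sup>\<smile>"
    by (simp add: conv_rcomp conv_sup rcomp_sup_distrib)
  then show ?thesis by (metis conv_conv)
qed

lemma rcomp_mono: "a \<le> a' \<Longrightarrow> b \<le> b' \<Longrightarrow> a \<odot> b \<le> a' \<odot> b'"
proof -
  assume "a \<le> a'" "b \<le> b'"
  then have "a' \<odot> b' = sup (sup a a' \<odot> b) (sup a a' \<odot> b')"
    by (simp add: sup_absorb2 flip: rcomp_sup_distrib_left)
  then show ?thesis
    unfolding rcomp_sup_distrib by (metis sup.assoc sup.cobounded1)
qed

lemma conv_mono: "a \<le> b \<Longrightarrow> a\<^sup>\<smile> \<le> b\<^sup>\<smile>"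
  by (metis conv_sup le_iff_sup)

lemma conv_le_iff: "a\<^sup>\<smile> \<le> b\<^sup>\<smile> \<longleftrightarrow> a \<le> b"
  by (metis conv_conv conv_mono)

lemma conv_bot: "bot\<^sup>\<smile> = bot"
  by (metis bot.extremum bot.extremum_uniqueI conv_conv conv_mono)

lemma conv_ident: "ident\<^sup>\<smile> = ident"
proof -
  have "ident = (ident\<^sup>\<smile> \<odot> ident)\<^sup>\<smile>"
    by (simp add: rcomp_ident conv_conv)
  also have "\<dots> = ident\<^sup>\<smile>"
    unfolding conv_rcomp by (simp add: rcomp_ident conv_conv)
  finally show ?thesis ..
qed

lemma ident_rcomp: "ident \<odot> a = a"
proof -
  have "(ident \<odot> a)\<^sup>\<smile> = a\<^sup>\<smile>"
    by (simp add: conv_rcomp conv_ident rcomp_ident)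
  then show ?thesis by (metis conv_conv)
qed

lemma rcomp_residual: "a\<^sup>\<smile> \<odot> - (a \<odot> b) \<le> - b"
  using tarski by (metis sup.cobounded2)

lemma rcomp_bot: "a \<odot> bot = bot"
proof -
  have "a \<odot> bot \<le> a \<odot> - (a\<^sup>\<smile> \<odot> top)"
    by (simp add: rcomp_mono)
  also have "\<dots> \<le> bot"
    using rcomp_residual[of "a\<^sup>\<smile>" top] by (simp add: conv_conv)
  finally show ?thesis by (simp add: bot_unique)
qed

lemma bot_rcomp: "bot \<odot> a = bot"
proof -
  have "(bot \<odot> a)\<^sup>\<smile> = bot\<^sup>\<smile>"
    by (simp add: conv_rcomp conv_bot rcomp_bot)
  then show ?thesis by (metis conv_conv)
qed

text \<open>From \<open>c \<le> - (a \<odot> b)\<close> the other inequality follows by monotonicity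
  and \<open>rcomp_residual\<close>; the same implication at the converse of a, with b and c
  exchanged, is the way back.\<close>

lemma schroeder: "inf c (a \<odot> b) = bot \<longleftrightarrow> inf b (a\<^sup>\<smile> \<odot> c) = bot"
proof -
  have *: "a\<^sup>\<smile> \<odot> c \<le> - b" if "c \<le> - (a \<odot> b)" for a b c
    using rcomp_mono[OF order_refl that] rcomp_residual order_trans by blast
  show ?thesis
    using *[of c a b] *[of b "a\<^sup>\<smile>" c]
    unfolding inf_shunt conv_conv by (auto intro: compl_le_swap1)
qed

end

section \<open>Atoms under converse and composition\<close>

lemma atom_conv:
  assumes "atom p"
  shows "atom (p\<^sup>\<smile>)"
  unfolding atom_def
proof (intro conjI allI impI)
  show "p\<^sup>\<smile> \<noteq> bot"
    using assms by (metis atom_def conv_bot conv_conv)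
  fix b assume "b \<noteq> bot \<and> b \<le> p\<^sup>\<smile>"
  then have "b\<^sup>\<smile> \<noteq> bot" "b\<^sup>\<smile> \<le> p"
    by (metis conv_bot conv_conv, metis conv_conv conv_mono)
  then show "b = p\<^sup>\<smile>"
    using assms by (metis atom_def conv_conv)
qed

text \<open>For an atom, lying below an element is the same as meeting it, so
  \<open>schroeder\<close> rotates a triangle of atoms. \<open>atom_cycle_left\<close> is the mirror
  image, by converse.\<close>

lemma atom_cycle_right:
  assumes "atom p" "atom r" "p \<le> q \<odot> r"
  shows "r \<le> q\<^sup>\<smile> \<odot> p"
  using assms by (simp add: atom_le_iff_inf schroeder[of p q r])

lemma atom_cycle_left:
  assumes "atom p" "atom q" "p \<le> q \<odot> r"
  shows "q \<le> p \<odot> r\<^sup>\<smile>"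
proof -
  have "p\<^sup>\<smile> \<le> r\<^sup>\<smile> \<odot> q\<^sup>\<smile>"
    using conv_mono[OF assms(3)] by (simp add: conv_rcomp)
  then have "q\<^sup>\<smile> \<le> (r\<^sup>\<smile>)\<^sup>\<smile> \<odot> p\<^sup>\<smile>"
    by (rule atom_cycle_right[OF atom_conv[OF assms(1)] atom_conv[OF assms(2)]])
  then show ?thesis
    unfolding conv_le_iff[of "q\<^sup>\<smile>", symmetric] conv_rcomp conv_conv .
qed

text \<open>Composition is additive on both sides, so for a fixed atom p the condition
  \<open>p \<le> a \<odot> b\<close> is prime in a and in b, and the factors can be shrunk to atoms
  one after the other. This is why demands with atoms q and r suffice in
  \<open>witnessed\<close>.\<close>

lemma atom_le_rcomp:
  fixes p a b :: "'a::{finite,relation_algebra}"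
  assumes "atom p" "p \<le> a \<odot> b"
  shows "\<exists>q r. atom q \<and> atom r \<and> q \<le> a \<and> r \<le> b \<and> p \<le> q \<odot> r"
proof -
  have nbot: "\<not> p \<le> bot"
    using assms(1) by (auto simp: atom_def bot_unique)
  obtain q where q: "atom q" "q \<le> a" "p \<le> q \<odot> b"
    using exists_atom_of_prime[of "\<lambda>q. p \<le> q \<odot> b" a] assms nbot
    by (auto simp: bot_rcomp rcomp_sup_distrib dest: atom_le_sup)
  obtain r where "atom r" "r \<le> b" "p \<le> q \<odot> r"
    using exists_atom_of_prime[of "\<lambda>r. p \<le> q \<odot> r" b] assms(1) q nbot
    by (auto simp: rcomp_bot rcomp_sup_distrib_left dest: atom_le_sup)
  with q show ?thesis by blast
qed

lemma ident_rcomp_le: "e \<le> ident \<Longrightarrow> e \<odot> a \<le> a" for a :: "'a::relation_algebra"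
  using rcomp_mono[of e ident a a] by (simp add: ident_rcomp)

lemma rcomp_ident_le: "e \<le> ident \<Longrightarrow> a \<odot> e \<le> a" for a :: "'a::relation_algebra"
  using rcomp_mono[of a a e ident] by (simp add: rcomp_ident)

section \<open>Networks\<close>

lemma consistentD:
  assumes "consistent (V, f)" "x \<in> V"
  shows "f (x, x) \<le> ident"
    and "y \<in> V \<Longrightarrow> z \<in> V \<Longrightarrow> f (x, y) \<le> f (x, z) \<odot> f (z, y)"
  using assms by (auto simp: consistent_def)

lemma atomicD: "atomic (V, f) \<Longrightarrow> x \<in> V \<Longrightarrow> y \<in> V \<Longrightarrow> atom (f (x, y))"
  by (auto simp: atomic_def)

lemma network_conv:
  assumes "consistent (V, f)" "atomic (V, f)" "x \<in> V" "y \<in> V"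
  shows "f (y, x) = (f (x, y))\<^sup>\<smile>"
proof -
  have "f (y, x) \<le> (f (x, y))\<^sup>\<smile> \<odot> f (x, x)"
    using assms by (intro atom_cycle_right consistentD(2)[of V]) (auto simp: atomic_def)
  also have "\<dots> \<le> (f (x, y))\<^sup>\<smile>"
    using assms by (intro rcomp_ident_le consistentD)
  finally show ?thesis
    using assms by (intro atom_le_atom atom_conv) (auto simp: atomic_def)
qed

text \<open>Composition with a subidentity element only shrinks, and comparable atoms are equal.
  Vertices joined by such an edge are thus twins, interchangeable in all their edges; the quotient
  of a saturated network rests on this.\<close>

lemma network_ident_right:
  assumes "consistent (V, f)" "atomic (V, f)" "x \<in> V" "y \<in> V" "z \<in> V" "f (y, z) \<le> ident"
  shows "f (x, y) = f (x, z)"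
proof -
  have "f (x, z) \<le> f (x, y) \<odot> f (y, z)"
    using assms by (intro consistentD(2)[of V])
  also have "\<dots> \<le> f (x, y)"
    using assms by (intro rcomp_ident_le)
  finally show ?thesis
    using atom_le_atom[OF atomicD[OF assms(2,3,5)] atomicD[OF assms(2,3,4)]] by simp
qed

lemma network_ident_left:
  assumes "consistent (V, f)" "atomic (V, f)" "x \<in> V" "y \<in> V" "z \<in> V" "f (y, z) \<le> ident"
  shows "f (y, x) = f (z, x)"
  using network_ident_right[OF assms] network_conv[OF assms(1,2,3,4)] network_conv[OF assms(1,2,3,5)]
  by simp

section \<open>Pulling back, extending and embedding networks\<close>

lemma can_iff:
  "(V, f) \<in> consistent_atomic_networks \<longleftrightarrow>
    finite V \<and> f \<in> V \<times> V \<rightarrow>\<^sub>E UNIV \<and> consistent (V, f) \<and> atomic (V, f)"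
  by (auto simp: consistent_atomic_networks_def network_def)

lemma can_restrict_iff:
  "(V, restrict f (V \<times> V)) \<in> consistent_atomic_networks \<longleftrightarrow>
    finite V \<and> consistent (V, f) \<and> atomic (V, f)"
  by (auto simp: can_iff consistent_def atomic_def)

text \<open>\<open>h\<close> may identify vertices: these become twins, since a loop of a consistent
  network lies below \<open>ident\<close>. One operation thus covers restriction, renaming and the
  duplication of a vertex.\<close>

definition pull :: "('u \<Rightarrow> 'v) \<Rightarrow> 'u set \<Rightarrow> ('v \<times> 'v \<Rightarrow> 'a) \<Rightarrow> 'u \<times> 'u \<Rightarrow> 'a" where
  "pull h V f = restrict (\<lambda>(x, y). f (h x, h y)) (V \<times> V)"

lemma pull_apply [simp]: "x \<in> V \<Longrightarrow> y \<in> V \<Longrightarrow> pull h V f (x, y) = f (h x, h y)"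
  by (simp add: pull_def)

lemma can_pull:
  assumes "(W, f) \<in> consistent_atomic_networks" "finite V" "h ` V \<subseteq> W"
  shows "(V, pull h V f) \<in> consistent_atomic_networks"
  unfolding pull_def can_restrict_iff using assms
  by (auto simp: can_iff consistent_def atomic_def image_subset_iff)

definition extends :: "('v, 'a) network \<Rightarrow> ('v, 'a) network \<Rightarrow> bool" where
  "extends = (\<lambda>(V, f) (W, g). V \<subseteq> W \<and> (\<forall>x\<in>V. \<forall>y\<in>V. g (x, y) = f (x, y)))"

text \<open>A satisfying assignment may identify twins, so \<open>s\<close> need not be
  injective.\<close>

definition embeds :: "('u, 'a) network \<Rightarrow> ('v, 'a) network \<Rightarrow> bool" where
  "embeds = (\<lambda>(V, f) (W, g). \<exists>s\<in>V \<rightarrow> W. \<forall>x\<in>V. \<forall>y\<in>V. g (s x, s y) = f (x, y))"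

lemma extends_refl: "extends N N"
  by (auto simp: extends_def)

lemma extends_trans: "extends N M \<Longrightarrow> extends M K \<Longrightarrow> extends N K"
  by (cases N, cases M, cases K) (simp add: extends_def subset_iff)

lemma embeds_trans:
  assumes "embeds N M" "embeds M K"
  shows "embeds N K"
proof -
  obtain V f W g X k where eq: "N = (V, f)" "M = (W, g)" "K = (X, k)"
    by (cases N, cases M, cases K)
  obtain s t where "s \<in> V \<rightarrow> W" "\<forall>x\<in>V. \<forall>y\<in>V. g (s x, s y) = f (x, y)"
    and "t \<in> W \<rightarrow> X" "\<forall>x\<in>W. \<forall>y\<in>W. k (t x, t y) = g (x, y)"
    using assms by (auto simp: eq embeds_def)
  then show ?thesis
    by (auto simp: eq embeds_def Pi_iff intro!: bexI[of _ "t \<circ> s"])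
qed

lemma extends_imp_embeds: "extends N M \<Longrightarrow> embeds N M"
  by (cases N, cases M) (auto simp: extends_def embeds_def intro!: bexI[of _ "\<lambda>x. x"])

lemma can_rename:
  assumes "(V, f) \<in> consistent_atomic_networks" "inj_on h V"
  shows "(h ` V, pull (inv_into V h) (h ` V) f) \<in> consistent_atomic_networks"
    and "embeds (V, f) (h ` V, pull (inv_into V h) (h ` V) f)"
proof -
  show "(h ` V, pull (inv_into V h) (h ` V) f) \<in> consistent_atomic_networks"
    using assms by (intro can_pull) (auto simp: can_iff)
  show "embeds (V, f) (h ` V, pull (inv_into V h) (h ` V) f)"
    using assms(2) by (auto simp: embeds_def intro!: bexI[of _ h])
qed

lemma AP_amalgam:
  assumes "AP C k l m" "(V\<^sub>1, f\<^sub>1) \<in> C" "(V\<^sub>2, f\<^sub>2) \<in> C"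
    "card V\<^sub>1 = k" "card (V\<^sub>1 \<inter> V\<^sub>2) = l" "card V\<^sub>2 = m"
    "\<And>a b. a \<in> V\<^sub>1 \<inter> V\<^sub>2 \<Longrightarrow> b \<in> V\<^sub>1 \<inter> V\<^sub>2 \<Longrightarrow> f\<^sub>1 (a, b) = f\<^sub>2 (a, b)"
  obtains f where "(V\<^sub>1 \<union> V\<^sub>2, f) \<in> C"
    "\<And>a b. a \<in> V\<^sub>1 \<Longrightarrow> b \<in> V\<^sub>1 \<Longrightarrow> f (a, b) = f\<^sub>1 (a, b)"
    "\<And>a b. a \<in> V\<^sub>2 \<Longrightarrow> b \<in> V\<^sub>2 \<Longrightarrow> f (a, b) = f\<^sub>2 (a, b)"
proof -
  have "\<exists>f. (V\<^sub>1 \<union> V\<^sub>2, f) \<in> C \<and>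
     (\<forall>a\<in>V\<^sub>1. \<forall>b\<in>V\<^sub>1. f (a, b) = f\<^sub>1 (a, b)) \<and> (\<forall>a\<in>V\<^sub>2. \<forall>b\<in>V\<^sub>2. f (a, b) = f\<^sub>2 (a, b))"
    using assms by (intro assms(1)[unfolded AP_def, rule_format]) blast
  then show thesis using that by blast
qed

text \<open>An injective \<open>h\<close> maps intersections to intersections, so the copies along
  \<open>h\<close> overlap exactly in the copied overlap, and their amalgam can be pulled back. This
  moves the hypothesis from the vertex type of the theorem to \<open>nat\<close>.\<close>

lemma AP_transfer:
  fixes h :: "'u \<Rightarrow> 'v"
  assumes AP: "AP (consistent_atomic_networks :: ('v, 'a::relation_algebra) network set) k l m"
    and h: "inj h"
  shows "AP (consistent_atomic_networks :: ('u, 'a) network set) k l m"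
  unfolding AP_def
proof (intro allI impI, elim conjE)
  fix V\<^sub>1 V\<^sub>2 :: "'u set" and f\<^sub>1 f\<^sub>2 :: "'u \<times> 'u \<Rightarrow> 'a"
  assume N: "(V\<^sub>1, f\<^sub>1) \<in> consistent_atomic_networks" "(V\<^sub>2, f\<^sub>2) \<in> consistent_atomic_networks"
    and card: "card V\<^sub>1 = k" "card (V\<^sub>1 \<inter> V\<^sub>2) = l" "card V\<^sub>2 = m"
    and agree: "\<forall>a \<in> V\<^sub>1 \<inter> V\<^sub>2. \<forall>b \<in> V\<^sub>1 \<inter> V\<^sub>2. f\<^sub>1 (a, b) = f\<^sub>2 (a, b)"
  have fin: "finite V\<^sub>1" "finite V\<^sub>2" using N by (auto simp: can_iff)
  have inv [simp]: "inv h (h x) = x" for x using h by simp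
  let ?g = "\<lambda>V f. pull (inv h) (h ` V) f"
  have int: "h ` V\<^sub>1 \<inter> h ` V\<^sub>2 = h ` (V\<^sub>1 \<inter> V\<^sub>2)"
    using h by (simp add: image_Int)
  have M: "(h ` V\<^sub>1, ?g V\<^sub>1 f\<^sub>1) \<in> consistent_atomic_networks"
    "(h ` V\<^sub>2, ?g V\<^sub>2 f\<^sub>2) \<in> consistent_atomic_networks"
    using N fin by (auto intro!: can_pull simp: image_image)
  have cards: "card (h ` V\<^sub>1) = k" "card (h ` V\<^sub>1 \<inter> h ` V\<^sub>2) = l" "card (h ` V\<^sub>2) = m"
    unfolding int using card h by (simp_all add: card_image inj_on_subset)
  have agree': "?g V\<^sub>1 f\<^sub>1 (a, b) = ?g V\<^sub>2 f\<^sub>2 (a, b)"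
    if "a \<in> h ` V\<^sub>1 \<inter> h ` V\<^sub>2" "b \<in> h ` V\<^sub>1 \<inter> h ` V\<^sub>2" for a b
    using that agree unfolding int by auto
  obtain g where g: "(h ` V\<^sub>1 \<union> h ` V\<^sub>2, g) \<in> consistent_atomic_networks"
    "\<And>a b. a \<in> h ` V\<^sub>1 \<Longrightarrow> b \<in> h ` V\<^sub>1 \<Longrightarrow> g (a, b) = ?g V\<^sub>1 f\<^sub>1 (a, b)"
    "\<And>a b. a \<in> h ` V\<^sub>2 \<Longrightarrow> b \<in> h ` V\<^sub>2 \<Longrightarrow> g (a, b) = ?g V\<^sub>2 f\<^sub>2 (a, b)"
    by (rule AP_amalgam[OF AP M cards agree'], assumption, assumption, rule that)
  have "(V\<^sub>1 \<union> V\<^sub>2, pull h (V\<^sub>1 \<union> V\<^sub>2) g) \<in> consistent_atomic_networks"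
    using g(1) fin by (auto intro!: can_pull)
  then show "\<exists>f. (V\<^sub>1 \<union> V\<^sub>2, f) \<in> consistent_atomic_networks \<and>
     (\<forall>a\<in>V\<^sub>1. \<forall>b\<in>V\<^sub>1. f (a, b) = f\<^sub>1 (a, b)) \<and> (\<forall>a\<in>V\<^sub>2. \<forall>b\<in>V\<^sub>2. f (a, b) = f\<^sub>2 (a, b))"
    using g(2,3) by (intro exI[of _ "pull h (V\<^sub>1 \<union> V\<^sub>2) g"]) auto
qed

section \<open>Representations with the universality property\<close>

lemma representationD:
  assumes "representation B R"
  shows "R a \<subseteq> B \<times> B" "R a \<subseteq> R top" "R bot = {}" "R ident = Id_on B" "R (- a) = R top - R a"
    "(u, v) \<in> R (a\<^sup>\<smile>) \<longleftrightarrow> (v, u) \<in> R a" "R (sup a b) = R a \<union> R b" "R (a \<odot> b) = R a O R b"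
  using assms by (auto simp: representation_def)

lemma representation_inf:
  assumes "representation B R"
  shows "R (inf a b) = R a \<inter> R b"
proof -
  have "inf a b = - sup (- a) (- b)" by simp
  then have "R (inf a b) = R top - ((R top - R a) \<union> (R top - R b))"
    by (simp only: representationD(5,7)[OF assms])
  then show ?thesis
    using representationD(2)[OF assms] by blast
qed

lemma representation_mono: "representation B R \<Longrightarrow> a \<le> b \<Longrightarrow> R a \<subseteq> R b"
  using representation_inf[of B R a b] by (auto simp: inf_absorb1)

text \<open>A common pair makes \<open>R (inf p a)\<close> nonempty, so \<open>inf p a\<close> is
  not \<open>bot\<close>. Inequalities with an atom on the left can thus be read off at a single
  pair.\<close>

lemma atom_le_representation:
  assumes "representation B R" "atom p" "(u, v) \<in> R p" "(u, v) \<in> R a"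
  shows "p \<le> a"
  using assms representation_inf[of B R p a] representationD(3)[of B R]
  by (auto simp: atom_le_iff_inf)

lemma atom_representation_unique:
  assumes "representation B R" "atom p" "atom q" "(u, v) \<in> R p" "(u, v) \<in> R q"
  shows "p = q"
  using atom_le_atom[OF assms(2,3) atom_le_representation[OF assms(1,2,4,5)]] .

text \<open>Finiteness puts every pair of \<open>R top\<close> into an atom, and each inequality of
  consistency is read off at the tuple itself. Repetitions in the tuple are allowed, as a glued
  point may coincide with an old one.\<close>

lemma exists_network_of_tuple:
  fixes R :: "'a::{finite,relation_algebra} \<Rightarrow> 'b rel"
  assumes rep: "representation B R" and fin: "finite V" and s: "s \<in> V \<rightarrow> B"
    and top: "\<And>x y. x \<in> V \<Longrightarrow> y \<in> V \<Longrightarrow> (s x, s y) \<in> R top"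
  shows "\<exists>f. (V, f) \<in> consistent_atomic_networks \<and> (\<forall>x\<in>V. \<forall>y\<in>V. (s x, s y) \<in> R (f (x, y)))"
proof -
  have ex: "\<exists>p. atom p \<and> (s x, s y) \<in> R p" if "x \<in> V" "y \<in> V" for x y
    using exists_atom_of_prime[of "\<lambda>a. (s x, s y) \<in> R a" top] top[OF that]
    unfolding representationD(3,7)[OF rep] by blast
  define f where "f = (\<lambda>(x, y). SOME p. atom p \<and> (s x, s y) \<in> R p)"
  have f: "atom (f (x, y)) \<and> (s x, s y) \<in> R (f (x, y))" if "x \<in> V" "y \<in> V" for x y
    using someI_ex[OF ex[OF that]] by (simp add: f_def)
  have "f (x, x) \<le> ident" if "x \<in> V" for x
    using f[OF that that] s that representationD(4)[OF rep]
    by (intro atom_le_representation[OF rep, of _ "s x" "s x"]) auto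
  moreover have "f (x, y) \<le> f (x, z) \<odot> f (z, y)" if "x \<in> V" "y \<in> V" "z \<in> V" for x y z
    using f[of x y] f[of x z] f[of z y] that representationD(8)[OF rep]
    by (intro atom_le_representation[OF rep, of _ "s x" "s y"]) auto
  ultimately have "(V, restrict f (V \<times> V)) \<in> consistent_atomic_networks"
    using f fin by (auto simp: can_restrict_iff consistent_def atomic_def)
  then show ?thesis
    using f by (intro exI[of _ "restrict f (V \<times> V)"]) auto
qed

lemma representation_top_trans:
  assumes "representation B R" "(u, v) \<in> R top" "(v, w) \<in> R top"
  shows "(u, w) \<in> R top"
proof -
  have "(u, w) \<in> R (top \<odot> top)"
    using assms representationD(8)[OF assms(1)] by auto
  then show ?thesis using representationD(2)[OF assms(1)] by auto
qed

lemma representation_top_sym: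
  assumes "representation B R" "(u, v) \<in> R top"
  shows "(v, u) \<in> R top"
  using assms representationD(2,6)[OF assms(1)] by blast

section \<open>From universal representations to amalgamation\<close>

lemma fully_universal_satisfiable:
  fixes V :: "'v set" and R :: "'a::relation_algebra \<Rightarrow> 'b rel"
  assumes "fully_universal TYPE('v) B R" "(V, f) \<in> consistent_atomic_networks"
  shows "\<exists>s. s \<in> V \<rightarrow> B \<and> (\<forall>x\<in>V. \<forall>y\<in>V. (s x, s y) \<in> R (f (x, y)))"
  using assms by (auto simp: fully_universal_def satisfiable_def)

lemma AP_if_fully_universal:
  fixes R :: "'a::{finite,relation_algebra} \<Rightarrow> 'b rel"
  assumes rep: "representation B R" and univ: "fully_universal TYPE('v) B R"
  shows "AP (consistent_atomic_networks :: ('v, 'a) network set) 3 2 n"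
  unfolding AP_def
proof (intro allI impI, elim conjE)
  fix V\<^sub>1 V\<^sub>2 :: "'v set" and f\<^sub>1 f\<^sub>2 :: "'v \<times> 'v \<Rightarrow> 'a"
  assume N: "(V\<^sub>1, f\<^sub>1) \<in> consistent_atomic_networks" "(V\<^sub>2, f\<^sub>2) \<in> consistent_atomic_networks"
    and card: "card V\<^sub>1 = 3" "card (V\<^sub>1 \<inter> V\<^sub>2) = 2"
    and agree: "\<forall>a \<in> V\<^sub>1 \<inter> V\<^sub>2. \<forall>b \<in> V\<^sub>1 \<inter> V\<^sub>2. f\<^sub>1 (a, b) = f\<^sub>2 (a, b)"
  have fin: "finite V\<^sub>1" "finite V\<^sub>2"
    and c1: "consistent (V\<^sub>1, f\<^sub>1)" "atomic (V\<^sub>1, f\<^sub>1)" and c2: "consistent (V\<^sub>2, f\<^sub>2)" "atomic (V\<^sub>2, f\<^sub>2)"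
    using N by (auto simp: can_iff)
  obtain x y where xy: "V\<^sub>1 \<inter> V\<^sub>2 = {x, y}" "x \<noteq> y"
    using card(2) by (auto simp: card_2_iff)
  have "card (V\<^sub>1 - V\<^sub>2) = 1"
    using card fin by (simp add: card_Diff_subset_Int)
  then obtain z where z: "V\<^sub>1 - V\<^sub>2 = {z}"
    by (auto simp: card_1_singleton_iff)
  have V1: "V\<^sub>1 = {x, y, z}" and zV2: "z \<notin> V\<^sub>2" and xyV2: "x \<in> V\<^sub>2" "y \<in> V\<^sub>2"
    using xy z by auto
  then have zxy: "z \<noteq> x" "z \<noteq> y" by auto
  obtain s where s: "s \<in> V\<^sub>2 \<rightarrow> B" "\<And>u v. u \<in> V\<^sub>2 \<Longrightarrow> v \<in> V\<^sub>2 \<Longrightarrow> (s u, s v) \<in> R (f\<^sub>2 (u, v))"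
    using fully_universal_satisfiable[OF univ N(2)] by auto
  have "(s x, s y) \<in> R (f\<^sub>1 (x, y))"
    using s(2)[of x y] xyV2 agree xy by simp
  also have "\<dots> \<subseteq> R (f\<^sub>1 (x, z) \<odot> f\<^sub>1 (z, y))"
    using c1 V1 by (intro representation_mono[OF rep] consistentD) auto
  finally obtain b where b: "(s x, b) \<in> R (f\<^sub>1 (x, z))" "(b, s y) \<in> R (f\<^sub>1 (z, y))"
    using representationD(8)[OF rep] by auto
  have bB: "b \<in> B" using b representationD(1)[OF rep] by blast
  define t where "t = s(z := b)"
  have t [simp]: "t z = b" "t x = s x" "t y = s y" and tV2: "u \<in> V\<^sub>2 \<Longrightarrow> t u = s u" for u
    using zxy zV2 by (auto simp: t_def)
  \<comment> \<open>In general \<open>R top\<close> is only an equivalence relation; the shared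
    vertex x ties all images to one class.\<close>
  have center: "(t u, s x) \<in> R top" if u: "u \<in> V\<^sub>1 \<union> V\<^sub>2" for u
  proof (cases "u = z")
    case True
    then show ?thesis
      using b(1) representation_top_sym[OF rep] representationD(2)[OF rep] by auto
  next
    case False
    then have "u \<in> V\<^sub>2" using u V1 xyV2 by auto
    then show ?thesis
      using s(2)[of u x] tV2 xyV2 representationD(2)[OF rep] by auto
  qed
  obtain f where f: "(V\<^sub>1 \<union> V\<^sub>2, f) \<in> consistent_atomic_networks"
    "\<forall>u\<in>V\<^sub>1 \<union> V\<^sub>2. \<forall>v\<in>V\<^sub>1 \<union> V\<^sub>2. (t u, t v) \<in> R (f (u, v))"
  proof -
    have "t \<in> V\<^sub>1 \<union> V\<^sub>2 \<rightarrow> B"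
      using s(1) bB xyV2 V1 tV2 by (auto simp: Pi_iff)
    moreover have "(t u, t v) \<in> R top" if "u \<in> V\<^sub>1 \<union> V\<^sub>2" "v \<in> V\<^sub>1 \<union> V\<^sub>2" for u v
      using center that representation_top_sym[OF rep] representation_top_trans[OF rep] by blast
    ultimately show thesis
      using exists_network_of_tuple[OF rep, of "V\<^sub>1 \<union> V\<^sub>2" t] fin that by auto
  qed
  have cf: "consistent (V\<^sub>1 \<union> V\<^sub>2, f)" "atomic (V\<^sub>1 \<union> V\<^sub>2, f)"
    using f(1) by (auto simp: can_iff)
  have eq2: "f (u, v) = f\<^sub>2 (u, v)" if "u \<in> V\<^sub>2" "v \<in> V\<^sub>2" for u v
    using that f(2)[rule_format, of u v] s(2)[of u v] tV2[of u] tV2[of v] cf(2) c2(2)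
    by (intro atom_representation_unique[OF rep, of _ _ "s u" "s v"]) (auto simp: atomic_def)
  have eq_xy: "f (u, v) = f\<^sub>1 (u, v)" if "u \<in> {x, y}" "v \<in> {x, y}" for u v
    using that eq2[of u v] agree xy xyV2 by auto
  have eq_at: "f (u, v) = f\<^sub>1 (u, v)" if "u \<in> V\<^sub>1" "v \<in> V\<^sub>1" "(t u, t v) \<in> R (f\<^sub>1 (u, v))" for u v
    using that f(2)[rule_format, of u v] cf(2) c1(2)
    by (intro atom_representation_unique[OF rep, of _ _ "t u" "t v"]) (auto simp: atomic_def)
  \<comment> \<open>The choice of b settles these two edges; their reverses are converses, and then
    only the loop at z remains.\<close>
  have eq_xz: "f (x, z) = f\<^sub>1 (x, z)" and eq_zy: "f (z, y) = f\<^sub>1 (z, y)"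
    using b V1 by (auto intro!: eq_at)
  then have eq_zx: "f (z, x) = f\<^sub>1 (z, x)" and eq_yz: "f (y, z) = f\<^sub>1 (y, z)"
    using network_conv[OF cf, of x z] network_conv[OF cf, of z y]
      network_conv[OF c1, of x z] network_conv[OF c1, of z y] V1 by simp_all
  \<comment> \<open>Since \<open>f\<^sub>1 (z, y)\<close> factors through
    \<open>f\<^sub>1 (z, z)\<close>, some pair of the latter relation starts at b; this relation
    lies in the diagonal, so the pair is the loop at b.\<close>
  have eq_zz: "f (z, z) = f\<^sub>1 (z, z)"
  proof (rule eq_at)
    have "f\<^sub>1 (z, y) \<le> f\<^sub>1 (z, z) \<odot> f\<^sub>1 (z, y)"
      using c1 V1 by (intro consistentD) auto
    then obtain c where c: "(b, c) \<in> R (f\<^sub>1 (z, z))"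
      using b(2) representation_mono[OF rep] representationD(8)[OF rep] by blast
    have "R (f\<^sub>1 (z, z)) \<subseteq> Id_on B"
      using representation_mono[OF rep, of "f\<^sub>1 (z, z)" ident] c1 V1 representationD(4)[OF rep]
      by (auto simp: consistent_def)
    with c show "(t z, t z) \<in> R (f\<^sub>1 (z, z))" by auto
  qed (use V1 in auto)
  have "\<forall>a\<in>V\<^sub>1. \<forall>b\<in>V\<^sub>1. f (a, b) = f\<^sub>1 (a, b)"
    unfolding V1 using eq_xy eq_xz eq_zy eq_zx eq_yz eq_zz by auto
  then show "\<exists>f. (V\<^sub>1 \<union> V\<^sub>2, f) \<in> consistent_atomic_networks \<and>
     (\<forall>a\<in>V\<^sub>1. \<forall>b\<in>V\<^sub>1. f (a, b) = f\<^sub>1 (a, b)) \<and> (\<forall>a\<in>V\<^sub>2. \<forall>b\<in>V\<^sub>2. f (a, b) = f\<^sub>2 (a, b))"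
    using f(1) eq2 by blast
qed

text \<open>The two networks are satisfied independently; squareness supplies the pairs across, so
  that \<open>exists_network_of_tuple\<close> applies to the joint assignment.\<close>

lemma JEP_if_square:
  fixes R :: "'a::{finite,relation_algebra} \<Rightarrow> 'b rel"
  assumes rep: "representation B R" and univ: "fully_universal TYPE('v) B R" and sq: "square B R"
  shows "JEP (consistent_atomic_networks :: ('v, 'a) network set)"
  unfolding JEP_def AP_def
proof (intro allI impI, elim conjE)
  fix V\<^sub>1 V\<^sub>2 :: "'v set" and f\<^sub>1 f\<^sub>2 :: "'v \<times> 'v \<Rightarrow> 'a"
  assume N: "(V\<^sub>1, f\<^sub>1) \<in> consistent_atomic_networks" "(V\<^sub>2, f\<^sub>2) \<in> consistent_atomic_networks"
    and card: "card (V\<^sub>1 \<inter> V\<^sub>2) = 0"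
  have fin: "finite V\<^sub>1" "finite V\<^sub>2" and at: "atomic (V\<^sub>1, f\<^sub>1)" "atomic (V\<^sub>2, f\<^sub>2)"
    using N by (auto simp: can_iff)
  then have disj: "V\<^sub>1 \<inter> V\<^sub>2 = {}" using card by simp
  obtain s\<^sub>1 s\<^sub>2 where s: "s\<^sub>1 \<in> V\<^sub>1 \<rightarrow> B" "\<forall>x\<in>V\<^sub>1. \<forall>y\<in>V\<^sub>1. (s\<^sub>1 x, s\<^sub>1 y) \<in> R (f\<^sub>1 (x, y))"
    "s\<^sub>2 \<in> V\<^sub>2 \<rightarrow> B" "\<forall>x\<in>V\<^sub>2. \<forall>y\<in>V\<^sub>2. (s\<^sub>2 x, s\<^sub>2 y) \<in> R (f\<^sub>2 (x, y))"
    using fully_universal_satisfiable[OF univ N(1)] fully_universal_satisfiable[OF univ N(2)] by blast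
  define t where "t u = (if u \<in> V\<^sub>1 then s\<^sub>1 u else s\<^sub>2 u)" for u
  have t1: "u \<in> V\<^sub>1 \<Longrightarrow> t u = s\<^sub>1 u" and t2: "u \<in> V\<^sub>2 \<Longrightarrow> t u = s\<^sub>2 u" for u
    using disj by (auto simp: t_def)
  have "t \<in> V\<^sub>1 \<union> V\<^sub>2 \<rightarrow> B" using s t1 t2 by (auto simp: Pi_iff)
  then obtain f where f: "(V\<^sub>1 \<union> V\<^sub>2, f) \<in> consistent_atomic_networks"
    "\<forall>u\<in>V\<^sub>1 \<union> V\<^sub>2. \<forall>v\<in>V\<^sub>1 \<union> V\<^sub>2. (t u, t v) \<in> R (f (u, v))"
    using exists_network_of_tuple[OF rep, of "V\<^sub>1 \<union> V\<^sub>2" t] fin sq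
    by (auto simp: square_def Pi_iff)
  have cf: "atomic (V\<^sub>1 \<union> V\<^sub>2, f)" using f(1) by (auto simp: can_iff)
  have "f (u, v) = f\<^sub>1 (u, v)" if "u \<in> V\<^sub>1" "v \<in> V\<^sub>1" for u v
    using that f(2)[rule_format, of u v] s(2) t1 cf at
    by (intro atom_representation_unique[OF rep, of _ _ "t u" "t v"]) (auto simp: atomic_def)
  moreover have "f (u, v) = f\<^sub>2 (u, v)" if "u \<in> V\<^sub>2" "v \<in> V\<^sub>2" for u v
    using that f(2)[rule_format, of u v] s(4) t2 cf at
    by (intro atom_representation_unique[OF rep, of _ _ "t u" "t v"]) (auto simp: atomic_def)
  ultimately show "\<exists>f. (V\<^sub>1 \<union> V\<^sub>2, f) \<in> consistent_atomic_networks \<and>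
     (\<forall>a\<in>V\<^sub>1. \<forall>b\<in>V\<^sub>1. f (a, b) = f\<^sub>1 (a, b)) \<and> (\<forall>a\<in>V\<^sub>2. \<forall>b\<in>V\<^sub>2. f (a, b) = f\<^sub>2 (a, b))"
    using f(1) by blast
qed

section \<open>Saturated networks\<close>

text \<open>Amalgamation wants a full network on three vertices, while a demand supplies only the
  edges q and r. The reverse edges must be their converses, and the loop at z a subidentity atom
  acting as a unit on both q and r. The inequalities are then rotations of
  \<open>f (x, y) \<le> q \<odot> r\<close> and unit laws.\<close>

lemma can_triangle:
  fixes p q r :: "'a::{finite,relation_algebra}"
  assumes xyz: "x \<noteq> y" "z \<noteq> x" "z \<noteq> y"
    and f: "consistent ({x, y}, f)" "atomic ({x, y}, f)"
    and qr: "atom q" "atom r" "f (x, y) \<le> q \<odot> r"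
  obtains g where "({x, y, z}, g) \<in> consistent_atomic_networks"
    "g (x, z) = q" "g (z, y) = r" "\<And>u v. u \<in> {x, y} \<Longrightarrow> v \<in> {x, y} \<Longrightarrow> g (u, v) = f (u, v)"
proof -
  let ?p = "f (x, y)"
  let ?e = "f (x, x)" and ?e' = "f (y, y)"
  have p: "atom ?p" and e: "atom ?e" "?e \<le> ident" and e': "atom ?e'" "?e' \<le> ident"
    using f by (auto simp: consistent_def atomic_def)
  have nbot: "\<not> s \<le> bot" if "atom s" for s :: 'a
    using that by (auto simp: atom_def bot_unique)
  \<comment> \<open>The product of a subidentity element and an atom lies below the atom, so it is
    either \<open>bot\<close> or the atom.\<close>
  have absorb_left: "d \<odot> s = s" if "d \<le> ident" "atom s" "d \<odot> s \<noteq> bot" for d s :: 'a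
    using that ident_rcomp_le[of d s] by (auto simp: atom_def)
  have absorb_right: "s \<odot> d = s" if "d \<le> ident" "atom s" "s \<odot> d \<noteq> bot" for d s :: 'a
    using that rcomp_ident_le[of d s] by (auto simp: atom_def)
  have loop: "d \<le> s\<^sup>\<smile> \<odot> s" if "s \<odot> d = s" "atom s" "atom d" for d s :: 'a
    using atom_cycle_right[of s d s] that by simp
  have loop': "d \<le> s \<odot> s\<^sup>\<smile>" if "d \<odot> s = s" "atom s" "atom d" for d s :: 'a
    using atom_cycle_left[of s d s] that by simp
  \<comment> \<open>The loop at z: the right factor obtained by splitting
    \<open>q \<le> q \<odot> ident\<close> into atoms.\<close>
  obtain e'' where e'': "atom e''" "e'' \<le> ident" "q \<odot> e'' = q"
  proof -
    obtain s d where sd: "atom s" "atom d" "s \<le> q" "d \<le> ident" "q \<le> s \<odot> d"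
      using atom_le_rcomp[of q q ident] qr(1) by (auto simp: rcomp_ident)
    then have "s = q" using qr(1) atom_le_atom by blast
    with sd rcomp_ident_le[of d q] have "q \<odot> d = q" by (simp add: order_antisym)
    with sd that show thesis by blast
  qed
  have eq: "?e \<odot> q = q"
  proof (rule absorb_left)
    have "?p \<le> ?e \<odot> ?p" using f by (auto simp: consistent_def)
    also have "\<dots> \<le> ?e \<odot> (q \<odot> r)" using qr by (intro rcomp_mono) auto
    also have "\<dots> = ?e \<odot> q \<odot> r" by (simp add: rcomp_assoc)
    finally show "?e \<odot> q \<noteq> bot" using nbot[OF p] by (auto simp: bot_rcomp)
  qed (use e qr in auto)
  have re': "r \<odot> ?e' = r"
  proof (rule absorb_right)
    have "?p \<le> ?p \<odot> ?e'" using f by (auto simp: consistent_def)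
    also have "\<dots> \<le> q \<odot> r \<odot> ?e'" using qr by (intro rcomp_mono) auto
    also have "\<dots> = q \<odot> (r \<odot> ?e')" by (simp add: rcomp_assoc)
    finally show "r \<odot> ?e' \<noteq> bot" using nbot[OF p] by (auto simp: rcomp_bot)
  qed (use e' qr in auto)
  \<comment> \<open>The unit chosen for q serves r as well: otherwise
    \<open>q \<odot> e'' \<odot> r\<close>, which lies above \<open>?p\<close>, would be
    \<open>bot\<close>.\<close>
  have e''r: "e'' \<odot> r = r"
  proof (rule absorb_left)
    have "?p \<le> q \<odot> (e'' \<odot> r)" using qr e'' by (simp flip: rcomp_assoc)
    then show "e'' \<odot> r \<noteq> bot" using nbot[OF p] by (auto simp: rcomp_bot)
  qed (use e'' qr in auto)
  have e''e'': "e'' \<odot> e'' = e''"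
  proof (rule absorb_left)
    have "q \<odot> (e'' \<odot> e'') = q" using e'' by (simp flip: rcomp_assoc)
    then show "e'' \<odot> e'' \<noteq> bot" using qr(1) by (auto simp: rcomp_bot atom_def)
  qed (use e'' in auto)
  define g where "g = (\<lambda>(u, v).
    if u = z then (if v = z then e'' else if v = x then q\<^sup>\<smile> else r)
    else if v = z then (if u = x then q else r\<^sup>\<smile>) else f (u, v))"
  have g: "g (x, x) = ?e" "g (x, y) = ?p" "g (y, x) = f (y, x)" "g (y, y) = ?e'" "g (z, z) = e''"
    "g (x, z) = q" "g (z, x) = q\<^sup>\<smile>" "g (z, y) = r" "g (y, z) = r\<^sup>\<smile>"
    using xyz by (auto simp: g_def)
  have fyx: "f (y, x) = ?p\<^sup>\<smile>" using network_conv[OF f, of x y] by simp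
  have conv_eq: "e'\<^sup>\<smile> = e'" if "e' = f (u, u)" "u \<in> {x, y}" for e' u
    using network_conv[OF f, of u u] that by simp
  have e''_conv: "e''\<^sup>\<smile> = e''"
  proof -
    have "e'' = e'' \<odot> e''" by (simp add: e''e'')
    then have "e'' \<le> e''\<^sup>\<smile> \<odot> e''" using atom_cycle_right[of e'' e'' e''] e'' by simp
    also have "\<dots> \<le> e''\<^sup>\<smile>" using e'' by (intro rcomp_ident_le)
    finally show ?thesis using atom_le_atom[OF e''(1) atom_conv[OF e''(1)]] by simp
  qed
  have conv_flip: "u\<^sup>\<smile> \<le> w\<^sup>\<smile> \<odot> v\<^sup>\<smile>" if "u \<le> v \<odot> w" for u v w :: 'a
    using conv_mono[OF that] by (simp add: conv_rcomp)
  have q_left: "q \<le> ?p \<odot> r\<^sup>\<smile>" and r_right: "r \<le> q\<^sup>\<smile> \<odot> ?p"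
    using atom_cycle_left[OF p qr(1,3)] atom_cycle_right[OF p qr(2,3)] by auto
  have tri: "q\<^sup>\<smile> \<le> r \<odot> ?p\<^sup>\<smile>" "r\<^sup>\<smile> \<le> ?p\<^sup>\<smile> \<odot> q" "?p\<^sup>\<smile> \<le> r\<^sup>\<smile> \<odot> q\<^sup>\<smile>"
    using conv_flip[OF q_left] conv_flip[OF r_right] conv_flip[OF qr(3)] by (simp_all add: conv_conv)
  have units: "q\<^sup>\<smile> \<le> e'' \<odot> q\<^sup>\<smile>" "q\<^sup>\<smile> \<le> q\<^sup>\<smile> \<odot> ?e" "r\<^sup>\<smile> \<le> ?e' \<odot> r\<^sup>\<smile>" "r\<^sup>\<smile> \<le> r\<^sup>\<smile> \<odot> e''"
    using conv_flip[of q q e''] conv_flip[of q ?e q] conv_flip[of r r ?e'] conv_flip[of r e'' r]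
      eq re' e''r e'' e''_conv conv_eq by simp_all
  have "consistent ({x, y, z}, g)"
    unfolding consistent_def prod.case
  proof (intro conjI ballI)
    fix u assume "u \<in> {x, y, z}"
    then show "g (u, u) \<le> ident"
      using e e' e'' by (auto simp: g)
  next
    fix u v w assume uvw: "u \<in> {x, y, z}" "v \<in> {x, y, z}" "w \<in> {x, y, z}"
    show "g (u, v) \<le> g (u, w) \<odot> g (w, v)"
    proof (cases "u \<in> {x, y} \<and> v \<in> {x, y} \<and> w \<in> {x, y}")
      case True
      then have "g (u, v) = f (u, v)" "g (u, w) = f (u, w)" "g (w, v) = f (w, v)"
        by (auto simp: g)
      with True f show ?thesis by (auto simp: consistent_def)
    next
      case False
      then consider "u = z" | "v = z" | "w = z" using uvw by auto
      moreover have "?e \<le> q \<odot> q\<^sup>\<smile>" "e'' \<le> q\<^sup>\<smile> \<odot> q" "e'' \<le> r \<odot> r\<^sup>\<smile>" "?e' \<le> r\<^sup>\<smile> \<odot> r"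
        using loop loop' eq e''(1,3) e''r re' qr e e' by auto
      ultimately show ?thesis
        using uvw tri units qr(3) q_left r_right eq re' e'' e''r e''e''
        by cases (auto simp: g fyx)
    qed
  qed
  moreover have "atomic ({x, y, z}, g)"
    using p e e' e'' qr fyx atom_conv by (auto simp: atomic_def g)
  ultimately have "({x, y, z}, restrict g ({x, y, z} \<times> {x, y, z})) \<in> consistent_atomic_networks"
    unfolding can_restrict_iff by simp
  then show thesis
    by (rule that) (use g xyz in auto)
qed

text \<open>Vacuous unless both \<open>x\<close> and \<open>y\<close> are vertices, so not preserved by extensions: a chain of networks
  has to return to every such demand infinitely often.\<close>

definition witnessed :: "'v \<Rightarrow> 'v \<Rightarrow> 'a \<Rightarrow> 'a \<Rightarrow> ('v, 'a::relation_algebra) network \<Rightarrow> bool" where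
  "witnessed x y q r = (\<lambda>(V, f). x \<in> V \<and> y \<in> V \<and> atom q \<and> atom r \<and> f (x, y) \<le> q \<odot> r \<longrightarrow>
     (\<exists>z\<in>V. f (x, z) = q \<and> f (z, y) = r))"

text \<open>The triangle on x, y and a fresh z meets V in exactly two vertices because x and y
  differ, so \<open>AP\<close> applies with n the size of V and adds the single vertex z.\<close>

lemma exists_witness_distinct:
  fixes V :: "'v::infinite set" and f :: "'v \<times> 'v \<Rightarrow> 'a::{finite,relation_algebra}"
  assumes AP: "\<And>n. AP (consistent_atomic_networks :: ('v, 'a) network set) 3 2 n"
    and N: "(V, f) \<in> consistent_atomic_networks"
    and xy: "x \<in> V" "y \<in> V" "x \<noteq> y" and qr: "atom q" "atom r" "f (x, y) \<le> q \<odot> r"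
  obtains W g z where "(W, g) \<in> consistent_atomic_networks" "extends (V, f) (W, g)"
    "z \<in> W" "g (x, z) = q" "g (z, y) = r"
proof -
  have V: "finite V" "consistent (V, f)" "atomic (V, f)"
    using N by (auto simp: can_iff)
  obtain z where z: "z \<notin> V" using arb_element[OF V(1)] by blast
  have "consistent ({x, y}, f)" "atomic ({x, y}, f)"
    using V xy by (auto simp: consistent_def atomic_def)
  moreover have "z \<noteq> x" "z \<noteq> y" using z xy by auto
  ultimately obtain t where t: "({x, y, z}, t) \<in> consistent_atomic_networks"
    "t (x, z) = q" "t (z, y) = r" "\<And>u v. u \<in> {x, y} \<Longrightarrow> v \<in> {x, y} \<Longrightarrow> t (u, v) = f (u, v)"
    using can_triangle[of x y z f q r] xy qr by blast
  have int: "{x, y, z} \<inter> V = {x, y}" using z xy by auto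
  have cards: "card {x, y, z} = 3" "card ({x, y, z} \<inter> V) = 2"
    unfolding int using z xy by (auto simp: card_insert_if)
  have agree: "t (a, b) = f (a, b)" if "a \<in> {x, y, z} \<inter> V" "b \<in> {x, y, z} \<inter> V" for a b
    using that t(4) unfolding int by blast
  obtain g where g: "({x, y, z} \<union> V, g) \<in> consistent_atomic_networks"
    "\<And>a b. a \<in> {x, y, z} \<Longrightarrow> b \<in> {x, y, z} \<Longrightarrow> g (a, b) = t (a, b)"
    "\<And>a b. a \<in> V \<Longrightarrow> b \<in> V \<Longrightarrow> g (a, b) = f (a, b)"
    by (rule AP_amalgam[OF AP t(1) N cards refl agree], assumption, assumption, rule that)
  show thesis
  proof (rule that[OF g(1)])
    show "extends (V, f) ({x, y, z} \<union> V, g)" using g(3) by (auto simp: extends_def)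
    show "g (x, z) = q" "g (z, y) = r" using g(2) t(2,3) by auto
  qed auto
qed

text \<open>The case \<open>x = y\<close> is reduced to distinct points by adding a twin of \<open>x\<close>.\<close>

lemma exists_witnessed_extension:
  fixes N :: "('v::infinite, 'a::{finite,relation_algebra}) network"
  assumes AP: "\<And>n. AP (consistent_atomic_networks :: ('v, 'a) network set) 3 2 n"
    and "N \<in> consistent_atomic_networks"
  shows "\<exists>M\<in>consistent_atomic_networks. extends N M \<and> witnessed x y q r M"
proof (cases "witnessed x y q r N")
  case True
  then show ?thesis using assms(2) extends_refl by blast
next
  case False
  obtain V f where N_eq: "N = (V, f)" by (cases N)
  have N: "(V, f) \<in> consistent_atomic_networks" and V: "finite V" "consistent (V, f)"
    using assms(2) by (auto simp: N_eq can_iff)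
  have xy: "x \<in> V" "y \<in> V" and qr: "atom q" "atom r" "f (x, y) \<le> q \<odot> r"
    using False by (auto simp: witnessed_def N_eq)
  show ?thesis
  proof (cases "x = y")
    case False
    then obtain W g z where "(W, g) \<in> consistent_atomic_networks" "extends (V, f) (W, g)"
      "z \<in> W" "g (x, z) = q" "g (z, y) = r"
      using exists_witness_distinct[OF AP N xy False qr] by blast
    then show ?thesis
      by (intro bexI[of _ "(W, g)"]) (auto simp: N_eq witnessed_def)
  next
    case True
    obtain x' where x': "x' \<notin> V" using arb_element[OF V(1)] by blast
    define h where "h = id(x' := x)"
    let ?V = "insert x' V"
    have h [simp]: "h x' = x" and [simp]: "u \<in> V \<Longrightarrow> h u = u" for u
      using x' by (auto simp: h_def)
    have N': "(?V, pull h ?V f) \<in> consistent_atomic_networks"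
      using can_pull[OF N, of ?V h] V(1) xy by auto
    obtain W g z where W: "(W, g) \<in> consistent_atomic_networks"
      "extends (?V, pull h ?V f) (W, g)" "z \<in> W" "g (x, z) = q" "g (z, x') = r"
      using exists_witness_distinct[OF AP N', of x x' q r] xy x' qr True by auto
    have g: "V \<subseteq> W" "x' \<in> W" "\<And>u v. u \<in> ?V \<Longrightarrow> v \<in> ?V \<Longrightarrow> g (u, v) = f (h u, h v)"
      using W(2) by (auto simp: extends_def)
    have "extends (V, f) (W, g)"
      using g by (auto simp: extends_def)
    \<comment> \<open>The edge between x' and x is a loop of f, hence subidentity, and the extension
      keeps it; so the witness for the pair of x and x' also serves the demand at x alone.\<close>
    moreover have "g (z, x') = g (z, x)"
    proof (rule network_ident_right[of W g])
      show "g (x', x) \<le> ident" using g(3)[of x' x] xy V by (simp add: consistent_def)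
    qed (use W(1,3) g(1,2) xy in \<open>auto simp: can_iff\<close>)
    ultimately show ?thesis
      using W True by (intro bexI[of _ "(W, g)"]) (auto simp: N_eq witnessed_def)
  qed
qed

text \<open>Joint embedding speaks of disjoint vertex sets, so M is first copied to fresh vertices,
  which an infinite type provides. This is why M is embedded and not extended.\<close>

lemma exists_embedding_extension:
  fixes N :: "('v::infinite, 'a::relation_algebra) network"
  assumes JEP: "JEP (consistent_atomic_networks :: ('v, 'a) network set)"
    and "N \<in> consistent_atomic_networks" "M \<in> consistent_atomic_networks"
  shows "\<exists>K\<in>consistent_atomic_networks. extends N K \<and> embeds M K"
proof -
  obtain V f W g where eq: "N = (V, f)" "M = (W, g)" by (cases N, cases M)
  have N: "(V, f) \<in> consistent_atomic_networks" and M: "(W, g) \<in> consistent_atomic_networks"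
    and fin: "finite V" "finite W"
    using assms by (auto simp: eq can_iff)
  obtain U where U: "V \<inter> U = {}" "finite U" "card W \<le> card U"
    using arb_finite_subset[OF fin(1)] by blast
  then obtain h where h: "h ` W \<subseteq> U" "inj_on h W"
    using card_le_inj[OF fin(2)] by blast
  let ?W = "h ` W" and ?g = "pull (inv_into W h) (h ` W) g"
  have M': "(?W, ?g) \<in> consistent_atomic_networks"
    and emb: "embeds (W, g) (?W, ?g)"
    using can_rename[OF M h(2)] .
  have disj: "V \<inter> ?W = {}" using U h by auto
  obtain k where k: "(V \<union> ?W, k) \<in> consistent_atomic_networks"
    "\<And>a b. a \<in> V \<Longrightarrow> b \<in> V \<Longrightarrow> k (a, b) = f (a, b)"
    "\<And>a b. a \<in> ?W \<Longrightarrow> b \<in> ?W \<Longrightarrow> k (a, b) = ?g (a, b)"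
    using AP_amalgam[OF _ N M' refl refl refl, of thesis] JEP disj by (auto simp: JEP_def)
  have "extends (?W, ?g) (V \<union> ?W, k)"
    using k(3) by (auto simp: extends_def)
  then have "embeds (W, g) (V \<union> ?W, k)"
    using emb embeds_trans extends_imp_embeds by blast
  moreover have "extends (V, f) (V \<union> ?W, k)"
    using k(2) by (auto simp: extends_def)
  ultimately show ?thesis
    using k(1) by (auto simp: eq)
qed

section \<open>Chains of networks and their limits\<close>

lemma exists_fair_chain:
  assumes "countable \<P>" "\<P> \<noteq> {}" "N\<^sub>0 \<in> C"
    and step: "\<forall>P\<in>\<P>. \<forall>N\<in>C. \<exists>M\<in>C. extends N M \<and> P M"
  shows "\<exists>N :: nat \<Rightarrow> ('v, 'a) network. N 0 = N\<^sub>0 \<and> (\<forall>k. N k \<in> C) \<and>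
    (\<forall>j k. j \<le> k \<longrightarrow> extends (N j) (N k)) \<and> (\<forall>P\<in>\<P>. \<forall>j. \<exists>k\<ge>j. P (N k))"
proof -
  \<comment> \<open>The second component of the decoded pair is ignored; it makes every task recur
    at arbitrarily late steps. Task k is carried out in passing from \<open>N k\<close> to
    \<open>N (Suc k)\<close>.\<close>
  define task where "task k = from_nat_into \<P> (fst (prod_decode k))" for k
  have task: "task k \<in> \<P>" for k
    using assms(2) by (simp add: task_def from_nat_into)
  \<comment> \<open>The clause for \<open>k = 0\<close> carries the prescribed start of the chain
    through the dependent choice.\<close>
  have "\<exists>N. \<forall>k. (N k \<in> C \<and> (k = 0 \<longrightarrow> N k = N\<^sub>0)) \<and> (extends (N k) (N (Suc k)) \<and> task k (N (Suc k)))"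
  proof (rule dependent_nat_choice)
    show "\<exists>N. N \<in> C \<and> (0 = (0::nat) \<longrightarrow> N = N\<^sub>0)"
      using assms(3) by blast
    show "\<exists>M. (M \<in> C \<and> (Suc k = 0 \<longrightarrow> M = N\<^sub>0)) \<and> (extends N M \<and> task k M)"
      if "N \<in> C \<and> (k = 0 \<longrightarrow> N = N\<^sub>0)" for N k
      using step[rule_format, OF task] that by blast
  qed
  then obtain N where N: "\<And>k. N k \<in> C" "N 0 = N\<^sub>0"
    "\<And>k. extends (N k) (N (Suc k))" "\<And>k. task k (N (Suc k))"
    by blast
  have "extends (N j) (N k)" if "j \<le> k" for j k
    using that
  proof (induction rule: dec_induct)
    case base
    show ?case by (rule extends_refl)
  next
    case (step n)
    then show ?case using N(3) extends_trans by blast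
  qed
  moreover have "\<exists>k\<ge>j. P (N k)" if P: "P \<in> \<P>" for P j
  proof -
    obtain i where i: "from_nat_into \<P> i = P"
      using from_nat_into_surj[OF assms(1) P] by blast
    have "P (N (Suc (prod_encode (i, j))))"
      using N(4)[of "prod_encode (i, j)"] i by (simp add: task_def)
    moreover have "j \<le> Suc (prod_encode (i, j))"
      using le_prod_encode_2[of j i] by simp
    ultimately show ?thesis by blast
  qed
  ultimately show ?thesis using N(1,2) by (intro exI[of _ N]) simp
qed

lemma exists_limit:
  fixes N :: "nat \<Rightarrow> ('v, 'a) network"
  assumes "\<And>j k. j \<le> k \<Longrightarrow> extends (N j) (N k)"
  shows "\<exists>F. \<forall>k. extends (N k) (\<Union>k. fst (N k), F)"
proof (intro exI allI)
  \<comment> \<open>The value is taken from the first stage that contains both points; all later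
    stages agree with it.\<close>
  define F where "F = (\<lambda>(x, y). snd (N (LEAST k. x \<in> fst (N k) \<and> y \<in> fst (N k))) (x, y))"
  fix k
  have "F (x, y) = snd (N k) (x, y)" if "x \<in> fst (N k)" "y \<in> fst (N k)" for x y
  proof -
    let ?j = "LEAST k. x \<in> fst (N k) \<and> y \<in> fst (N k)"
    have "x \<in> fst (N ?j) \<and> y \<in> fst (N ?j)" "?j \<le> k"
      using that LeastI[of "\<lambda>k. x \<in> fst (N k) \<and> y \<in> fst (N k)" k]
        Least_le[of "\<lambda>k. x \<in> fst (N k) \<and> y \<in> fst (N k)" k] by auto
    then show ?thesis
      using assms[of ?j k] by (auto simp: F_def extends_def split: prod.splits)
  qed
  then show "extends (N k) (\<Union>k. fst (N k), F)"
    unfolding extends_def by (auto simp: case_prod_beta)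
qed

definition saturated :: "('v, 'a::relation_algebra) network \<Rightarrow> bool" where
  "saturated N \<longleftrightarrow> consistent N \<and> atomic N \<and> (\<forall>x y q r. witnessed x y q r N)"

text \<open>One chain serves both parts of the theorem: T is empty when each network gets a
  component of its own, and consists of all networks over \<open>nat\<close> under joint
  embedding.\<close>

lemma exists_saturated:
  fixes N\<^sub>0 :: "(nat, 'a::{finite,relation_algebra}) network"
  assumes AP: "\<And>n. AP (consistent_atomic_networks :: (nat, 'a) network set) 3 2 n"
    and N\<^sub>0: "N\<^sub>0 \<in> consistent_atomic_networks" and T: "countable T"
    and joint: "\<And>(N :: (nat, 'a) network) M. N \<in> consistent_atomic_networks \<Longrightarrow> M \<in> T \<Longrightarrow>
      \<exists>K\<in>consistent_atomic_networks. extends N K \<and> embeds M K"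
  obtains V F where "saturated (V, F)" "extends N\<^sub>0 (V, F)" "\<And>M. M \<in> T \<Longrightarrow> embeds M (V, F)"
proof -
  let ?\<P> = "(\<lambda>(x, y, q, r). witnessed x y q r) ` UNIV \<union> embeds ` T :: ((nat, 'a) network \<Rightarrow> bool) set"
  have "countable (UNIV :: (nat \<times> nat \<times> 'a \<times> 'a) set)"
    by (simp add: countable_finite flip: UNIV_Times_UNIV)
  then have countable: "countable ?\<P>"
    using T by (intro countable_Un countable_image)
  have nonempty: "?\<P> \<noteq> {}" by blast
  have step: "\<forall>P\<in>?\<P>. \<forall>N\<in>consistent_atomic_networks.
      \<exists>M\<in>consistent_atomic_networks. extends N M \<and> P M"
  proof (intro ballI)
    fix P and N :: "(nat, 'a) network"
    assume P: "P \<in> ?\<P>" and N: "N \<in> consistent_atomic_networks"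
    consider x y q r where "P = witnessed x y q r" | M where "M \<in> T" "P = embeds M"
      using P by auto
    then show "\<exists>M\<in>consistent_atomic_networks. extends N M \<and> P M"
      using exists_witnessed_extension[OF AP N] joint[OF N] by cases auto
  qed
  obtain N :: "nat \<Rightarrow> (nat, 'a) network"
    where chain: "N 0 = N\<^sub>0" "\<forall>k. N k \<in> consistent_atomic_networks"
      "\<forall>j k. j \<le> k \<longrightarrow> extends (N j) (N k)" "\<forall>P\<in>?\<P>. \<forall>j. \<exists>k\<ge>j. P (N k)"
    using exists_fair_chain[OF countable nonempty N\<^sub>0 step] by (elim exE conjE) (rule that)
  note N = chain(1) chain(2-4)[rule_format]
  have "\<exists>F. \<forall>k. extends (N k) (\<Union>k. fst (N k), F)"
    by (rule exists_limit, rule N(3))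
  then obtain F where F: "\<And>k. extends (N k) (\<Union>k. fst (N k), F)"
    by (elim exE) (rule that, rule spec)
  let ?V = "\<Union>k. fst (N k)"
  define W f where "W k = fst (N k)" and "f k = snd (N k)" for k
  have N_eq: "N k = (W k, f k)" for k by (simp add: W_def f_def)
  have V: "?V = (\<Union>k. W k)" by (simp add: W_def)
  have Ff: "F (x, y) = f k (x, y)" if "x \<in> W k" "y \<in> W k" for x y k
    using F[of k] that by (auto simp: N_eq extends_def)
  have mono: "W j \<subseteq> W k" if "j \<le> k" for j k
    using N(3)[OF that] by (auto simp: N_eq extends_def)
  \<comment> \<open>Consistency involves three vertices at a time, and any three appear together at
    some stage, so it passes to the limit.\<close>
  have common: "\<exists>k. x \<in> W k \<and> y \<in> W k \<and> z \<in> W k" if xyz: "x \<in> ?V" "y \<in> ?V" "z \<in> ?V" for x y z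
  proof -
    obtain i j k where "x \<in> W i" "y \<in> W j" "z \<in> W k" using xyz V by auto
    then show ?thesis
      using mono[of i "i + j + k"] mono[of j "i + j + k"] mono[of k "i + j + k"] by auto
  qed
  have Wf: "consistent (W k, f k)" "atomic (W k, f k)" for k
    using N(2)[of k] by (auto simp: N_eq can_iff)
  have "F (x, x) \<le> ident \<and> atom (F (x, y)) \<and> F (x, y) \<le> F (x, z) \<odot> F (z, y)"
    if xyz: "x \<in> ?V" "y \<in> ?V" "z \<in> ?V" for x y z
  proof -
    obtain k where k: "x \<in> W k" "y \<in> W k" "z \<in> W k"
      using common[OF xyz] by blast
    then show ?thesis
      using Wf[of k] by (auto simp: Ff[of _ k] consistent_def atomic_def)
  qed
  then have "consistent (?V, F)" "atomic (?V, F)"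
    by (auto simp: consistent_def atomic_def)
  moreover have "witnessed x y q r (?V, F)" for x y q r
    unfolding witnessed_def prod.case
  proof (intro impI, elim conjE)
    assume xy: "x \<in> ?V" "y \<in> ?V" and qr: "atom q" "atom r" "F (x, y) \<le> q \<odot> r"
    obtain j where j: "x \<in> W j" "y \<in> W j" using common[OF xy xy(2)] by blast
    have "witnessed x y q r \<in> ?\<P>" by force
    \<comment> \<open>A stage after j contains both endpoints, so the demand is met there and not
      merely vacuous.\<close>
    then obtain k where k: "j \<le> k" "witnessed x y q r (N k)" using N(4) by blast
    then have xyk: "x \<in> W k" "y \<in> W k" using j mono by auto
    then obtain z where "z \<in> W k" "f k (x, z) = q" "f k (z, y) = r"
      using k(2) qr by (auto simp: witnessed_def N_eq Ff[of _ k])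
    then show "\<exists>z\<in>?V. F (x, z) = q \<and> F (z, y) = r"
      using xyk by (intro bexI[of _ z]) (auto simp: Ff[of _ k] V)
  qed
  moreover have "embeds M (?V, F)" if "M \<in> T" for M
  proof -
    obtain k where "embeds M (N k)" using N(4)[of "embeds M" 0] \<open>M \<in> T\<close> by blast
    then show ?thesis using F embeds_trans extends_imp_embeds by blast
  qed
  moreover have "extends N\<^sub>0 (?V, F)" using F[of 0] N(1) by simp
  ultimately show thesis by (intro that[of ?V F]) (simp_all add: saturated_def)
qed

section \<open>Representations from saturated networks\<close>

lemma countable_can:
  "countable (consistent_atomic_networks :: ('v::countable, 'a::{finite,relation_algebra}) network set)"
proof (rule countable_subset)
  \<comment> \<open>Values outside \<open>V \<times> V\<close> are fixed, so each finite V carries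
    only finitely many networks.\<close>
  show "consistent_atomic_networks \<subseteq> (SIGMA V : Collect finite. V \<times> V \<rightarrow>\<^sub>E (UNIV :: 'a set))"
    by (auto simp: consistent_atomic_networks_def network_def)
  show "countable (SIGMA V : Collect (finite :: 'v set \<Rightarrow> bool). V \<times> V \<rightarrow>\<^sub>E (UNIV :: 'a set))"
    by (intro countable_SIGMA countable_Collect_finite countable_PiE) (auto intro: countable_finite)
qed

text \<open>For composition, consistency gives one inclusion and saturation the other; the Boolean
  operations are respected because an atom lies below exactly one of an element and its complement,
  and below a join only if below a part.\<close>

lemma representation_of_saturated_family:
  fixes V :: "'i::countable \<Rightarrow> 'c::countable set" and F :: "'i \<Rightarrow> 'c \<times> 'c \<Rightarrow> 'a::{finite,relation_algebra}"
  assumes sat: "\<And>i. saturated (V i, F i)"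
  shows "\<exists>(B :: 'b::infinite set) R \<sigma>. representation B R \<and> B = (\<Union>i. \<sigma> i ` V i) \<and>
    (\<forall>i j. \<forall>x\<in>V i. \<forall>y\<in>V j. \<forall>a. (\<sigma> i x, \<sigma> j y) \<in> R a \<longleftrightarrow> i = j \<and> F i (x, y) \<le> a)"
proof -
  have c: "consistent (V i, F i)" "atomic (V i, F i)" for i
    using sat by (auto simp: saturated_def)
  have refl: "F i (x, x) \<le> ident" if "x \<in> V i" for i x
    using consistentD(1)[OF c(1) that] .
  have atoms: "atom (F i (x, y))" if "x \<in> V i" "y \<in> V i" for i x y
    using atomicD[OF c(2) that] .
  have conv: "F i (y, x) = (F i (x, y))\<^sup>\<smile>" if "x \<in> V i" "y \<in> V i" for i x y
    using network_conv[OF c that] .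
  obtain h :: "nat \<Rightarrow> 'b" where h: "inj h"
    using infinite_countable_subset[OF infinite_UNIV] by blast
  \<comment> \<open>Twins satisfy the same predicate, so \<open>SOME\<close> picks the same
    representative for them: the quotient is realized by a choice function.\<close>
  define rep where "rep i x = (SOME y. y \<in> V i \<and> F i (x, y) \<le> ident)" for i x
  \<comment> \<open>Encoding the index together with the representative keeps different components
    disjoint inside the infinite type.\<close>
  define \<sigma> where "\<sigma> i x = h (to_nat (i, rep i x))" for i x
  have rep: "rep i x \<in> V i \<and> F i (x, rep i x) \<le> ident" if "x \<in> V i" for i x
    unfolding rep_def by (rule someI[of _ x]) (use that refl in auto)
  have \<sigma>_eq: "\<sigma> i x = \<sigma> j y \<longleftrightarrow> i = j \<and> F i (x, y) \<le> ident"
    if xy: "x \<in> V i" "y \<in> V j" for i j x y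
  proof
    assume "\<sigma> i x = \<sigma> j y"
    then have ij: "i = j" and rep_eq: "rep i x = rep j y"
      using h by (auto simp: \<sigma>_def dest: injD)
    have "F i (x, y) = F i (x, rep i x)"
      using rep[of x i] rep[of y j] xy ij rep_eq by (intro network_ident_right[OF c]) auto
    then show "i = j \<and> F i (x, y) \<le> ident"
      using rep[of x i] xy ij by simp
  next
    assume *: "i = j \<and> F i (x, y) \<le> ident"
    have "F i (x, z) = F i (y, z)" if "z \<in> V i" for z
      using xy * that by (intro network_ident_left[OF c]) auto
    then have "(\<lambda>z. z \<in> V i \<and> F i (x, z) \<le> ident) = (\<lambda>z. z \<in> V i \<and> F i (y, z) \<le> ident)"
      by auto
    then show "\<sigma> i x = \<sigma> j y"
      using * by (simp add: \<sigma>_def rep_def)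
  qed
  define B where "B = (\<Union>i. \<sigma> i ` V i)"
  define R where "R a = {(\<sigma> i x, \<sigma> i y) | i x y. x \<in> V i \<and> y \<in> V i \<and> F i (x, y) \<le> a}" for a
  have R_iff: "(\<sigma> i x, \<sigma> j y) \<in> R a \<longleftrightarrow> i = j \<and> F i (x, y) \<le> a"
    if xy: "x \<in> V i" "y \<in> V j" for i j x y a
  proof
    assume "(\<sigma> i x, \<sigma> j y) \<in> R a"
    then obtain k x' y' where k: "\<sigma> i x = \<sigma> k x'" "\<sigma> j y = \<sigma> k y'" "x' \<in> V k" "y' \<in> V k" "F k (x', y') \<le> a"
      by (auto simp: R_def)
    then have eq: "i = k" "j = k" and ids: "F k (x, x') \<le> ident" "F k (y, y') \<le> ident"
      using \<sigma>_eq xy by auto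
    have "F k (x, y) = F k (x', y)"
      using xy k eq ids by (intro network_ident_left[OF c]) auto
    also have "\<dots> = F k (x', y')"
      using xy k eq ids by (intro network_ident_right[OF c]) auto
    finally show "i = j \<and> F i (x, y) \<le> a"
      using eq k(5) by simp
  qed (use xy in \<open>auto simp: R_def\<close>)
  have B_cases: "\<exists>i x. x \<in> V i \<and> u = \<sigma> i x" if "u \<in> B" for u
    using that by (auto simp: B_def)
  have \<sigma>_B: "\<sigma> i x \<in> B" if "x \<in> V i" for i x
    using that by (auto simp: B_def)
  have R_B: "R a \<subseteq> B \<times> B" for a
    using \<sigma>_B by (auto simp: R_def)
  have rel_eqI: "S = T" if sub: "S \<subseteq> B \<times> B" "T \<subseteq> B \<times> B"
    and eq: "\<And>i j x y. x \<in> V i \<Longrightarrow> y \<in> V j \<Longrightarrow> (\<sigma> i x, \<sigma> j y) \<in> S \<longleftrightarrow> (\<sigma> i x, \<sigma> j y) \<in> T" for S T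
  proof -
    have "(u, v) \<in> S \<longleftrightarrow> (u, v) \<in> T" if "u \<in> B" "v \<in> B" for u v
      using B_cases[OF \<open>u \<in> B\<close>] B_cases[OF \<open>v \<in> B\<close>] eq by blast
    with sub show ?thesis by auto
  qed
  have "representation B R"
    unfolding representation_def
  proof (intro conjI allI)
    show "R a \<subseteq> B \<times> B" for a by (rule R_B)
    show "R bot = {}"
      using atoms by (auto simp: R_def bot_unique atom_def)
    show "R top = (\<Union>a. R a)"
      by (auto simp: R_def)
    show "R ident = Id_on B"
      by (rule rel_eqI) (use R_B in \<open>auto simp: R_iff \<sigma>_eq \<sigma>_B Id_on_iff\<close>)
    show "R (- a) = R top - R a" for a
    proof (rule rel_eqI)
      fix i j x y assume "x \<in> V i" "y \<in> V j"
      then show "(\<sigma> i x, \<sigma> j y) \<in> R (- a) \<longleftrightarrow> (\<sigma> i x, \<sigma> j y) \<in> R top - R a"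
        using atom_le_uminus[OF atoms] by (auto simp: R_iff)
    qed (use R_B in auto)
    show "R (a\<^sup>\<smile>) = {(u, v). (v, u) \<in> R a}" for a
    proof (rule rel_eqI)
      fix i j x y assume "x \<in> V i" "y \<in> V j"
      then show "(\<sigma> i x, \<sigma> j y) \<in> R (a\<^sup>\<smile>) \<longleftrightarrow> (\<sigma> i x, \<sigma> j y) \<in> {(u, v). (v, u) \<in> R a}"
        using conv[of y i x] conv_le_iff[of "F i (y, x)" a] by (auto simp: R_iff)
    qed (use R_B in auto)
    show "R (sup a b) = R a \<union> R b" for a b
    proof (rule rel_eqI)
      fix i j x y assume "x \<in> V i" "y \<in> V j"
      then show "(\<sigma> i x, \<sigma> j y) \<in> R (sup a b) \<longleftrightarrow> (\<sigma> i x, \<sigma> j y) \<in> R a \<union> R b"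
        using atom_le_sup[OF atoms, of x i y a b] by (auto simp: R_iff le_supI1 le_supI2)
    qed (use R_B in auto)
    show "R (a \<odot> b) = R a O R b" for a b
    proof (rule rel_eqI)
      fix i j x y assume xy: "x \<in> V i" "y \<in> V j"
      show "(\<sigma> i x, \<sigma> j y) \<in> R (a \<odot> b) \<longleftrightarrow> (\<sigma> i x, \<sigma> j y) \<in> R a O R b"
      proof
        assume "(\<sigma> i x, \<sigma> j y) \<in> R (a \<odot> b)"
        then have ij: "i = j" and le: "F i (x, y) \<le> a \<odot> b"
          using R_iff[OF xy] by auto
        obtain q r where qr: "atom q" "atom r" "q \<le> a" "r \<le> b" "F i (x, y) \<le> q \<odot> r"
          using atom_le_rcomp[OF atoms le] xy ij by blast
        have "witnessed x y q r (V i, F i)"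
          using sat by (simp add: saturated_def)
        then obtain z where "z \<in> V i" "F i (x, z) = q" "F i (z, y) = r"
          using xy ij qr by (auto simp: witnessed_def)
        then have "(\<sigma> i x, \<sigma> i z) \<in> R a" "(\<sigma> i z, \<sigma> j y) \<in> R b"
          using xy ij qr by (auto simp: R_iff)
        then show "(\<sigma> i x, \<sigma> j y) \<in> R a O R b" by blast
      next
        assume "(\<sigma> i x, \<sigma> j y) \<in> R a O R b"
        then obtain w where w: "(\<sigma> i x, w) \<in> R a" "(w, \<sigma> j y) \<in> R b" by blast
        then obtain k z where "z \<in> V k" "w = \<sigma> k z"
          using B_cases R_B by blast
        with w have z: "z \<in> V i" and ij: "i = j" and le: "F i (x, z) \<le> a" "F i (z, y) \<le> b"
          using xy by (auto simp: R_iff)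
        have "F i (x, y) \<le> F i (x, z) \<odot> F i (z, y)"
          using consistentD(2)[OF c(1)] xy z ij by simp
        also have "\<dots> \<le> a \<odot> b"
          using le by (rule rcomp_mono)
        finally show "(\<sigma> i x, \<sigma> j y) \<in> R (a \<odot> b)"
          using R_iff[OF xy] ij by simp
      qed
    qed (use R_B in \<open>auto simp: relcomp_unfold\<close>)
  qed
  then show ?thesis
    using B_def R_iff by (intro exI[of _ B] exI[of _ R] exI[of _ \<sigma>]) simp
qed

text \<open>A network has finitely many vertices, hence a copy over \<open>nat\<close> whatever its
  vertex type; an embedding of the copy followed by \<open>\<sigma> i\<close> is a satisfying
  assignment.\<close>

lemma fully_universal_of_embeddings:
  fixes V :: "'i \<Rightarrow> nat set" and F :: "'i \<Rightarrow> nat \<times> nat \<Rightarrow> 'a::relation_algebra"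
  assumes emb: "\<And>M :: (nat, 'a) network. M \<in> consistent_atomic_networks \<Longrightarrow> \<exists>i. embeds M (V i, F i)"
    and \<sigma>: "\<And>i x. x \<in> V i \<Longrightarrow> \<sigma> i x \<in> B"
    and R: "\<And>i x y. x \<in> V i \<Longrightarrow> y \<in> V i \<Longrightarrow> (\<sigma> i x, \<sigma> i y) \<in> R (F i (x, y))"
  shows "fully_universal TYPE('v) B R"
  unfolding fully_universal_def
proof
  fix N :: "('v, 'a) network"
  assume N: "N \<in> consistent_atomic_networks"
  obtain W g where N_eq: "N = (W, g)" by (cases N)
  have fin: "finite W" using N by (simp add: N_eq can_iff)
  obtain h :: "'v \<Rightarrow> nat" where h: "inj_on h W"
    using finite_imp_inj_to_nat_seg[OF fin] by blast
  note M = can_rename[OF N[unfolded N_eq] h]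
  obtain i where "embeds (W, g) (V i, F i)"
    using emb[OF M(1)] embeds_trans[OF M(2)] by blast
  then obtain s where s: "s \<in> W \<rightarrow> V i" "\<forall>x\<in>W. \<forall>y\<in>W. F i (s x, s y) = g (x, y)"
    by (auto simp: embeds_def)
  have "(\<sigma> i (s x), \<sigma> i (s y)) \<in> R (g (x, y))" if "x \<in> W" "y \<in> W" for x y
    using R[of "s x" i "s y"] s that by (simp add: Pi_iff)
  then show "satisfiable B R N"
    using \<sigma> s(1) by (auto simp: N_eq satisfiable_def Pi_iff intro!: exI[of _ "\<lambda>x. \<sigma> i (s x)"])
qed

text \<open>Ensures that there is a network to enumerate even in the one-element algebra, which has
  no atoms, and starts the chain of the square case.\<close>

lemma empty_can: "({}, \<lambda>_. undefined) \<in> consistent_atomic_networks"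
  by (simp add: can_iff consistent_def atomic_def)

lemma exists_fully_universal_representation:
  assumes AP: "\<And>n. AP (consistent_atomic_networks :: (nat, 'a) network set) 3 2 n"
  shows "\<exists>(B :: 'b::infinite set) (R :: 'a::{finite,relation_algebra} \<Rightarrow> 'b rel).
    representation B R \<and> fully_universal TYPE('v) B R"
proof -
  define N :: "nat \<Rightarrow> (nat, 'a) network" where "N = from_nat_into consistent_atomic_networks"
  have N: "N i \<in> consistent_atomic_networks" for i
    unfolding N_def using empty_can by (intro from_nat_into) blast
  have "\<exists>VF. saturated VF \<and> extends (N i) VF" for i
  proof -
    obtain V F where "saturated (V, F)" "extends (N i) (V, F)"
      \<comment> \<open>Each component grows from its own network, so T is empty.\<close>
      by (rule exists_saturated[OF AP N[of i], of "{}"]) auto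
    then show ?thesis by blast
  qed
  then obtain VF where VF: "\<And>i. saturated (VF i)" "\<And>i. extends (N i) (VF i)" by metis
  define V F where "V i = fst (VF i)" and "F i = snd (VF i)" for i
  have sat: "saturated (V i, F i)" and ext: "extends (N i) (V i, F i)" for i
    using VF by (simp_all add: V_def F_def)
  obtain B :: "'b set" and R \<sigma> where rep: "representation B R" and B: "B = (\<Union>i. \<sigma> i ` V i)"
    and R: "\<forall>i j. \<forall>x\<in>V i. \<forall>y\<in>V j. \<forall>a. (\<sigma> i x, \<sigma> j y) \<in> R a \<longleftrightarrow> i = j \<and> F i (x, y) \<le> a"
    using representation_of_saturated_family[of V F, OF sat] by (elim exE conjE) (rule that)
  have "fully_universal TYPE('v) B R"
  proof (rule fully_universal_of_embeddings)
    fix M :: "(nat, 'a) network"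
    assume "M \<in> consistent_atomic_networks"
    then obtain i where "N i = M"
      unfolding N_def using from_nat_into_surj[OF countable_can] by blast
    then show "\<exists>i. embeds M (V i, F i)"
      using ext extends_imp_embeds by blast
  qed (auto simp: B R)
  with rep show ?thesis by blast
qed

lemma exists_fully_universal_square_representation:
  assumes AP: "\<And>n. AP (consistent_atomic_networks :: (nat, 'a) network set) 3 2 n"
    and JEP: "JEP (consistent_atomic_networks :: (nat, 'a) network set)"
  shows "\<exists>(B :: 'b::infinite set) (R :: 'a::{finite,relation_algebra} \<Rightarrow> 'b rel).
    representation B R \<and> fully_universal TYPE('v) B R \<and> square B R"
proof -
  obtain V :: "nat set" and F where sat: "saturated (V, F)"
    and emb: "\<And>M :: (nat, 'a) network. M \<in> consistent_atomic_networks \<Longrightarrow> embeds M (V, F)"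
  proof (rule exists_saturated[OF AP empty_can countable_can])
    show "\<exists>K\<in>consistent_atomic_networks. extends N K \<and> embeds M K"
      if "N \<in> consistent_atomic_networks" "M \<in> consistent_atomic_networks"
      for N M :: "(nat, 'a) network"
      using exists_embedding_extension[OF JEP that] .
  qed (rule that, assumption, blast)
  \<comment> \<open>The index type \<open>unit\<close> stands for a single component.\<close>
  obtain B :: "'b set" and R and \<sigma> :: "unit \<Rightarrow> nat \<Rightarrow> 'b"
    where rep: "representation B R" and B: "B = (\<Union>i. \<sigma> i ` V)"
    and R: "\<forall>i j. \<forall>x\<in>V. \<forall>y\<in>V. \<forall>a. (\<sigma> i x, \<sigma> j y) \<in> R a \<longleftrightarrow> i = j \<and> F (x, y) \<le> a"
    using representation_of_saturated_family[of "\<lambda>_. V" "\<lambda>_. F", OF sat] by (elim exE conjE) (rule that)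
  have "fully_universal TYPE('v) B R"
    by (rule fully_universal_of_embeddings[of "\<lambda>_. V" "\<lambda>_. F" \<sigma>]) (auto simp: B R emb)
  \<comment> \<open>Indices in \<open>unit\<close> are equal and every atom lies below
    \<open>top\<close>, so any two points are related.\<close>
  moreover have "square B R"
    using representationD(1)[OF rep, of top] by (auto simp: square_def B R)
  ultimately show ?thesis using rep by blast
qed

theorem corollary2p41:
  shows
    "((\<exists>(B :: ('b::infinite) set) (R :: ('a::{finite,relation_algebra}) \<Rightarrow> 'b rel).
         representation B R \<and> fully_universal TYPE('v::infinite) B R) \<longleftrightarrow>
      (\<forall>n. AP (consistent_atomic_networks :: ('v, 'a) network set) 3 2 n))
     \<and>
     ((\<exists>(B :: 'b set) (R :: 'a \<Rightarrow> 'b rel).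
         representation B R \<and> fully_universal TYPE('v) B R \<and> square B R) \<longleftrightarrow>
      (JEP (consistent_atomic_networks :: ('v, 'a) network set) \<and>
       (\<forall>n. AP (consistent_atomic_networks :: ('v, 'a) network set) 3 2 n)))"
proof -
  obtain h :: "nat \<Rightarrow> 'v" where h: "inj h"
    using infinite_countable_subset[OF infinite_UNIV] by blast
  have AP_nat: "AP (consistent_atomic_networks :: (nat, 'a) network set) k l m"
    if "AP (consistent_atomic_networks :: ('v, 'a) network set) k l m" for k l m
    using AP_transfer[OF that h] .
  have JEP_nat: "JEP (consistent_atomic_networks :: (nat, 'a) network set)"
    if "JEP (consistent_atomic_networks :: ('v, 'a) network set)"
    using AP_nat that by (simp add: JEP_def)
  show ?thesis
  proof (intro conjI iffI allI)
    assume "\<forall>n. AP (consistent_atomic_networks :: ('v, 'a) network set) 3 2 n"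
    then show "\<exists>(B :: 'b set) (R :: 'a \<Rightarrow> 'b rel). representation B R \<and> fully_universal TYPE('v) B R"
      by (intro exists_fully_universal_representation AP_nat) blast
  next
    assume "JEP (consistent_atomic_networks :: ('v, 'a) network set) \<and>
       (\<forall>n. AP (consistent_atomic_networks :: ('v, 'a) network set) 3 2 n)"
    then show "\<exists>(B :: 'b set) (R :: 'a \<Rightarrow> 'b rel).
        representation B R \<and> fully_universal TYPE('v) B R \<and> square B R"
      by (intro exists_fully_universal_square_representation AP_nat JEP_nat) blast+
  qed (use AP_if_fully_universal JEP_if_square in blast)+
qed

end
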